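(* Let $\mathcal A$ be a unital $C^*$-algebra and let $x$ be a linear extreme point of the closed unit ball $\mathcal A_1$ of $\mathcal A$. Then $x$ is also a linear extreme point of the closed unit ball $\mathcal A_1^{**}$ of the bidual $\mathcal A^{**}$. In particular, every linear extreme point of $\mathcal A_1$ is a weak$^*$-extreme point of $\mathcal A_1$ and remains so in all the biduals, i.e., it is a weak$^*$-extreme point of the closed unit ball of every even-order dual of $\mathcal A$.
   Context: A Banach space $X$ is regarded as a subspace of its bidual $X^{**}$ via the canonical embedding. A linear extreme point is an extreme point in the usual sense of convexity. A weak$^*$-extreme point of the closed unit ball $X_1$ is a linear extreme point of $X_1$ that is also a linear extreme point of the closed unit ball $X_1^{**}$ of $X^{**}$. *)

theory Defs
  imports Complex_Main "HOL-Library.FuncSet" "HOL-Algebra.Module"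
begin

section \<open>Complex normed spaces and unital C*-algebras\<close>

text \<open>
  Spaces have explicit carriers, because the duals of a space are sets of functionals and the
  order of the dual is a variable. The fields \<open>mult\<close> and \<open>one\<close> of a record describing a mere
  normed space are irrelevant, as usual for modules in HOL-Algebra.
\<close>

definition complex_ring :: "complex ring" where
  "complex_ring = \<lparr>carrier = UNIV, monoid.mult = (*), one = 1, zero = 0, add = (+)\<rparr>"

record 'a nspace = "(complex, 'a) module" +
  vnorm :: "'a \<Rightarrow> real"

record 'a star_alg = "'a nspace" +
  adj :: "'a \<Rightarrow> 'a"

locale complex_normed_space =
  module complex_ring X for X :: "('a, 'm) nspace_scheme" (structure) +
  assumes vnorm_nonneg: "x \<in> carrier X \<Longrightarrow> 0 \<le> vnorm X x"
    and vnorm_eq_zero: "x \<in> carrier X \<Longrightarrow> vnorm X x = 0 \<longleftrightarrow> x = \<zero>\<^bsub>X\<^esub>"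
    and vnorm_smult: "x \<in> carrier X \<Longrightarrow> vnorm X (c \<odot>\<^bsub>X\<^esub> x) = cmod c * vnorm X x"
    and vnorm_triangle:
      "x \<in> carrier X \<Longrightarrow> y \<in> carrier X \<Longrightarrow> vnorm X (x \<oplus>\<^bsub>X\<^esub> y) \<le> vnorm X x + vnorm X y"

locale complex_banach_space = complex_normed_space X for X :: "('a, 'm) nspace_scheme" (structure) +
  assumes complete:
    "\<lbrakk> \<And>n::nat. s n \<in> carrier X;
       \<And>e. e > 0 \<Longrightarrow> \<exists>N. \<forall>m\<ge>N. \<forall>n\<ge>N. vnorm X (s m \<ominus>\<^bsub>X\<^esub> s n) < e \<rbrakk>
     \<Longrightarrow> \<exists>l\<in>carrier X. (\<lambda>n. vnorm X (s n \<ominus>\<^bsub>X\<^esub> l)) \<longlonglongrightarrow> 0"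

text \<open>The zero algebra is not excluded.\<close>

locale unital_cstar_algebra =
  complex_banach_space A + ring A for A :: "('a, 'm) star_alg_scheme" (structure) +
  assumes smult_mult_left:
      "x \<in> carrier A \<Longrightarrow> y \<in> carrier A \<Longrightarrow>
         (c \<odot>\<^bsub>A\<^esub> x) \<otimes>\<^bsub>A\<^esub> y = c \<odot>\<^bsub>A\<^esub> (x \<otimes>\<^bsub>A\<^esub> y)"
    and smult_mult_right:
      "x \<in> carrier A \<Longrightarrow> y \<in> carrier A \<Longrightarrow>
         x \<otimes>\<^bsub>A\<^esub> (c \<odot>\<^bsub>A\<^esub> y) = c \<odot>\<^bsub>A\<^esub> (x \<otimes>\<^bsub>A\<^esub> y)"
    and vnorm_mult:
      "x \<in> carrier A \<Longrightarrow> y \<in> carrier A \<Longrightarrow> vnorm A (x \<otimes>\<^bsub>A\<^esub> y) \<le> vnorm A x * vnorm A y"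
    and adj_closed: "x \<in> carrier A \<Longrightarrow> adj A x \<in> carrier A"
    and adj_adj: "x \<in> carrier A \<Longrightarrow> adj A (adj A x) = x"
    and adj_add:
      "x \<in> carrier A \<Longrightarrow> y \<in> carrier A \<Longrightarrow> adj A (x \<oplus>\<^bsub>A\<^esub> y) = adj A x \<oplus>\<^bsub>A\<^esub> adj A y"
    and adj_smult: "x \<in> carrier A \<Longrightarrow> adj A (c \<odot>\<^bsub>A\<^esub> x) = cnj c \<odot>\<^bsub>A\<^esub> adj A x"
    and adj_mult:
      "x \<in> carrier A \<Longrightarrow> y \<in> carrier A \<Longrightarrow> adj A (x \<otimes>\<^bsub>A\<^esub> y) = adj A y \<otimes>\<^bsub>A\<^esub> adj A x"
    and cstar_identity:
      "x \<in> carrier A \<Longrightarrow> vnorm A (adj A x \<otimes>\<^bsub>A\<^esub> x) = (vnorm A x)\<^sup>2"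


section \<open>Extreme points, duals, weak*-extreme points\<close>

definition unit_ball :: "('a, 'm) nspace_scheme \<Rightarrow> 'a set" where
  "unit_ball X = {x \<in> carrier X. vnorm X x \<le> 1}"

text \<open>This is \<open>extreme_point_of\<close> of HOL-Analysis, with the operations of \<open>X\<close>.\<close>

definition linear_extreme_point :: "('a, 'm) nspace_scheme \<Rightarrow> 'a set \<Rightarrow> 'a \<Rightarrow> bool" where
  "linear_extreme_point X S x \<longleftrightarrow>
     x \<in> S \<and>
     (\<forall>a\<in>S. \<forall>b\<in>S. \<forall>t::real. 0 < t \<and> t < 1 \<and>
        x = (complex_of_real (1 - t) \<odot>\<^bsub>X\<^esub> a) \<oplus>\<^bsub>X\<^esub> (complex_of_real t \<odot>\<^bsub>X\<^esub> b) \<longrightarrow> a = b)"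

definition bounded_functional :: "('a, 'm) nspace_scheme \<Rightarrow> ('a \<Rightarrow> complex) \<Rightarrow> bool" where
  "bounded_functional X f \<longleftrightarrow>
     (\<forall>x\<in>carrier X. \<forall>y\<in>carrier X. f (x \<oplus>\<^bsub>X\<^esub> y) = f x + f y) \<and>
     (\<forall>c. \<forall>x\<in>carrier X. f (c \<odot>\<^bsub>X\<^esub> x) = c * f x) \<and>
     (\<exists>K. \<forall>x\<in>carrier X. cmod (f x) \<le> K * vnorm X x)"

text \<open>Functionals are extensional, so that they are determined by their values on the carrier.\<close>

definition dual :: "('a, 'm) nspace_scheme \<Rightarrow> ('a \<Rightarrow> complex) nspace" where
  "dual X =
     \<lparr> carrier = {f \<in> extensional (carrier X). bounded_functional X f},
       monoid.mult = undefined, one = undefined,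
       zero = (\<lambda>x\<in>carrier X. 0),
       add = (\<lambda>f g. \<lambda>x\<in>carrier X. f x + g x),
       smult = (\<lambda>c f. \<lambda>x\<in>carrier X. c * f x),
       vnorm = (\<lambda>f. SUP x\<in>unit_ball X. cmod (f x)) \<rparr>"

abbreviation bidual :: "('a, 'm) nspace_scheme \<Rightarrow> (('a \<Rightarrow> complex) \<Rightarrow> complex) nspace" where
  "bidual X \<equiv> dual (dual X)"

definition canonical_embedding ::
    "('a, 'm) nspace_scheme \<Rightarrow> 'a \<Rightarrow> (('a \<Rightarrow> complex) \<Rightarrow> complex)" where
  "canonical_embedding X x = (\<lambda>f\<in>carrier (dual X). f x)"

definition weak_star_extreme_point :: "('a, 'm) nspace_scheme \<Rightarrow> 'a \<Rightarrow> bool" where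
  "weak_star_extreme_point X x \<longleftrightarrow>
     linear_extreme_point X (unit_ball X) x \<and>
     linear_extreme_point (bidual X) (unit_ball (bidual X)) (canonical_embedding X x)"


section \<open>Duals of variable order\<close>

definition isometric_isomorphism ::
    "('a, 'm) nspace_scheme \<Rightarrow> ('b, 'n) nspace_scheme \<Rightarrow> ('a \<Rightarrow> 'b) \<Rightarrow> bool" where
  "isometric_isomorphism X Y \<phi> \<longleftrightarrow>
     bij_betw \<phi> (carrier X) (carrier Y) \<and>
     \<phi> \<zero>\<^bsub>X\<^esub> = \<zero>\<^bsub>Y\<^esub> \<and>
     (\<forall>x\<in>carrier X. \<forall>y\<in>carrier X. \<phi> (x \<oplus>\<^bsub>X\<^esub> y) = \<phi> x \<oplus>\<^bsub>Y\<^esub> \<phi> y) \<and>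
     (\<forall>c. \<forall>x\<in>carrier X. \<phi> (c \<odot>\<^bsub>X\<^esub> x) = c \<odot>\<^bsub>Y\<^esub> \<phi> x) \<and>
     (\<forall>x\<in>carrier X. vnorm Y (\<phi> x) = vnorm X x)"

text \<open>
  The type of \<open>dual X\<close> differs from that of \<open>X\<close>, so the \<open>m\<close>-th dual cannot be a function of a
  variable \<open>m\<close>. Instead, \<open>dual_tower X m D \<iota> T\<close> says that \<open>D 0, \<dots>, D m\<close> are copies
  of the duals of \<open>X\<close> of order \<open>0, \<dots>, m\<close> inside one common type \<open>'u\<close>: \<open>\<iota>\<close> identifies \<open>X\<close>
  with \<open>D 0\<close>, and \<open>T k\<close> identifies the dual of \<open>D k\<close> with \<open>D (k + 1)\<close>. The maps point towards the
  copies, so that the whole structure of each \<open>D k\<close> is determined by them. For each \<open>m\<close> such a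
  tower exists over a suitable type, see \<open>dual_tower_0\<close> and \<open>dual_tower_Suc\<close> below. In general
  HOL has no type that carries an infinite tower, hence the bound \<open>m\<close>.
\<close>

definition dual_tower ::
    "('a, 'm) nspace_scheme \<Rightarrow> nat \<Rightarrow> (nat \<Rightarrow> 'u nspace) \<Rightarrow> ('a \<Rightarrow> 'u) \<Rightarrow>
     (nat \<Rightarrow> ('u \<Rightarrow> complex) \<Rightarrow> 'u) \<Rightarrow> bool" where
  "dual_tower X m D \<iota> T \<longleftrightarrow>
     isometric_isomorphism X (D 0) \<iota> \<and>
     (\<forall>k<m. isometric_isomorphism (dual (D k)) (D (Suc k)) (T k))"

text \<open>
  The canonical embedding of \<open>D k\<close> into its bidual \<open>D (k + 2)\<close>: the image of \<open>y\<close> is the element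
  corresponding to the functional on \<open>D (k + 1)\<close> that evaluates at \<open>y\<close> the functional on \<open>D k\<close>
  corresponding to its argument.
\<close>

definition tower_embedding ::
    "(nat \<Rightarrow> 'u nspace) \<Rightarrow> (nat \<Rightarrow> ('u \<Rightarrow> complex) \<Rightarrow> 'u) \<Rightarrow> nat \<Rightarrow> 'u \<Rightarrow> 'u" where
  "tower_embedding D T k y =
     T (k + 1) (\<lambda>z\<in>carrier (D (k + 1)). inv_into (carrier (dual (D k))) (T k) z y)"

primrec even_dual_embedding ::
    "(nat \<Rightarrow> 'u nspace) \<Rightarrow> ('a \<Rightarrow> 'u) \<Rightarrow> (nat \<Rightarrow> ('u \<Rightarrow> complex) \<Rightarrow> 'u) \<Rightarrow> nat \<Rightarrow> 'a \<Rightarrow> 'u" where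
  "even_dual_embedding D \<iota> T 0 x = \<iota> x"
| "even_dual_embedding D \<iota> T (Suc n) x =
     tower_embedding D T (2 * n) (even_dual_embedding D \<iota> T n x)"


section \<open>Existence of dual towers\<close>

lemma dual_tower_0:
  "\<exists>(D :: nat \<Rightarrow> 'a nspace) \<iota> T. dual_tower (X :: ('a, 'm) nspace_scheme) 0 D \<iota> T"
proof -
  have "isometric_isomorphism X (nspace.truncate X) id"
    by (simp add: isometric_isomorphism_def nspace.defs bij_betw_def)
  then show ?thesis
    by (intro exI[of _ "\<lambda>_. nspace.truncate X"] exI[of _ id]) (simp add: dual_tower_def)
qed

definition closed_ops :: "('a, 'm) nspace_scheme \<Rightarrow> bool" where
  "closed_ops X \<longleftrightarrow> \<zero>\<^bsub>X\<^esub> \<in> carrier X \<and>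
     (\<forall>x\<in>carrier X. \<forall>y\<in>carrier X. x \<oplus>\<^bsub>X\<^esub> y \<in> carrier X) \<and>
     (\<forall>c. \<forall>x\<in>carrier X. c \<odot>\<^bsub>X\<^esub> x \<in> carrier X)"

lemma closed_ops_normed: "complex_normed_space X \<Longrightarrow> closed_ops X"
proof -
  assume "complex_normed_space X"
  then interpret complex_normed_space X .
  show ?thesis
    by (auto simp: closed_ops_def intro!: smult_closed) (simp add: complex_ring_def)
qed

lemma iso_closed_ops:
  assumes "isometric_isomorphism X Y \<phi>" "closed_ops X"
  shows "closed_ops Y"
proof -
  have img: "carrier Y = \<phi> ` carrier X"
    using assms(1) by (auto simp: isometric_isomorphism_def bij_betw_def)
  note d = assms(1)[unfolded isometric_isomorphism_def] assms(2)[unfolded closed_ops_def]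
  have z: "\<zero>\<^bsub>Y\<^esub> = \<phi> \<zero>\<^bsub>X\<^esub>"
    and a: "\<And>x y. x \<in> carrier X \<Longrightarrow> y \<in> carrier X \<Longrightarrow> \<phi> x \<oplus>\<^bsub>Y\<^esub> \<phi> y = \<phi> (x \<oplus>\<^bsub>X\<^esub> y)"
    and s: "\<And>c x. x \<in> carrier X \<Longrightarrow> c \<odot>\<^bsub>Y\<^esub> \<phi> x = \<phi> (c \<odot>\<^bsub>X\<^esub> x)"
    using d by auto
  have c: "\<zero>\<^bsub>X\<^esub> \<in> carrier X"
     "\<And>x y. x \<in> carrier X \<Longrightarrow> y \<in> carrier X \<Longrightarrow> x \<oplus>\<^bsub>X\<^esub> y \<in> carrier X"
     "\<And>c x. x \<in> carrier X \<Longrightarrow> c \<odot>\<^bsub>X\<^esub> x \<in> carrier X"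
    using d by auto
  show ?thesis unfolding closed_ops_def by (simp add: img z a s c)
qed

lemma iso_comp:
  assumes "isometric_isomorphism X Y \<phi>" "isometric_isomorphism Y Z \<psi>"
  shows "isometric_isomorphism X Z (\<psi> \<circ> \<phi>)"
proof -
  have "\<And>x. x \<in> carrier X \<Longrightarrow> \<phi> x \<in> carrier Y"
    using assms(1) by (auto simp: isometric_isomorphism_def bij_betw_def)
  then show ?thesis
    using assms bij_betw_trans[of \<phi> "carrier X" "carrier Y" \<psi> "carrier Z"]
    unfolding isometric_isomorphism_def by simp
qed

lemma closed_ops_dual:
  assumes "closed_ops X" shows "closed_ops (dual X)"
proof -
  have c: "\<And>x y. x \<in> carrier X \<Longrightarrow> y \<in> carrier X \<Longrightarrow> x \<oplus>\<^bsub>X\<^esub> y \<in> carrier X"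
     "\<And>c x. x \<in> carrier X \<Longrightarrow> c \<odot>\<^bsub>X\<^esub> x \<in> carrier X"
    using assms by (auto simp: closed_ops_def)
  have add: "\<exists>K. \<forall>x\<in>carrier X. cmod (f x + g x) \<le> K * vnorm X x"
    if "\<forall>x\<in>carrier X. cmod (f x) \<le> K * vnorm X x" "\<forall>x\<in>carrier X. cmod (g x) \<le> L * vnorm X x"
    for f g K L
    using that by (intro exI[of _ "K + L"])
      (auto simp: distrib_right intro!: order_trans[OF norm_triangle_ineq] add_mono)
  have smult: "\<exists>K. \<forall>x\<in>carrier X. cmod b * cmod (f x) \<le> K * vnorm X x"
    if "\<forall>x\<in>carrier X. cmod (f x) \<le> K * vnorm X x" for f K and b :: complex
    using that by (intro exI[of _ "cmod b * K"]) (simp add: mult.assoc mult_left_mono)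
  have zero: "\<exists>K. \<forall>x\<in>carrier X. 0 \<le> K * vnorm X x"
    by (rule exI[of _ 0]) simp
  show ?thesis
    using add smult zero
    by (auto simp: closed_ops_def dual_def bounded_functional_def c algebra_simps norm_mult)
qed

lemma iso_dual:
  assumes iso: "isometric_isomorphism X Y \<phi>" and cl: "closed_ops X"
  shows "isometric_isomorphism (dual Y) (dual X) (\<lambda>f. \<lambda>x\<in>carrier X. f (\<phi> x))"
proof -
  have b: "bij_betw \<phi> (carrier X) (carrier Y)"
    and img: "carrier Y = \<phi> ` carrier X" and inj: "inj_on \<phi> (carrier X)"
    using iso by (auto simp: isometric_isomorphism_def bij_betw_def)
  note d = iso[unfolded isometric_isomorphism_def] cl[unfolded closed_ops_def]
  have a: "\<And>x y. x \<in> carrier X \<Longrightarrow> y \<in> carrier X \<Longrightarrow> \<phi> x \<oplus>\<^bsub>Y\<^esub> \<phi> y = \<phi> (x \<oplus>\<^bsub>X\<^esub> y)"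
    and s: "\<And>c x. x \<in> carrier X \<Longrightarrow> c \<odot>\<^bsub>Y\<^esub> \<phi> x = \<phi> (c \<odot>\<^bsub>X\<^esub> x)"
    and n: "\<And>x. x \<in> carrier X \<Longrightarrow> vnorm Y (\<phi> x) = vnorm X x"
    using d by auto
  have c: "\<And>x y. x \<in> carrier X \<Longrightarrow> y \<in> carrier X \<Longrightarrow> x \<oplus>\<^bsub>X\<^esub> y \<in> carrier X"
     "\<And>c x. x \<in> carrier X \<Longrightarrow> c \<odot>\<^bsub>X\<^esub> x \<in> carrier X"
    using d by auto
  let ?F = "\<lambda>f. \<lambda>x\<in>carrier X. f (\<phi> x)"
  let ?G = "\<lambda>g. \<lambda>y\<in>carrier Y. g (inv_into (carrier X) \<phi> y)"
  have bf: "bounded_functional X (?F f) \<longleftrightarrow> bounded_functional Y f" for f :: "_ \<Rightarrow> complex"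
    by (simp add: bounded_functional_def img a s n c)
  have FG: "?F (?G g) = g" if "g \<in> extensional (carrier X)" for g :: "_ \<Rightarrow> complex"
    using that by (auto simp: fun_eq_iff img inj extensional_def)
  have GF: "?G (?F f) = f" if "f \<in> extensional (carrier Y)" for f :: "_ \<Rightarrow> complex"
    using that by (auto simp: fun_eq_iff img inj extensional_def)
  have bij: "bij_betw ?F (carrier (dual Y)) (carrier (dual X))"
  proof (rule bij_betw_byWitness[where f' = ?G])
    show "?G ` carrier (dual X) \<subseteq> carrier (dual Y)"
    proof
      fix h assume "h \<in> ?G ` carrier (dual X)"
      then obtain g where g: "h = ?G g" "g \<in> extensional (carrier X)" "bounded_functional X g"
        by (auto simp: dual_def)
      have "bounded_functional X (?F h)" using g FG by simp
      then show "h \<in> carrier (dual Y)" unfolding bf using g(1) by (simp add: dual_def)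
    qed
  qed (use FG GF bf in \<open>auto simp: dual_def\<close>)
  have ball: "unit_ball Y = \<phi> ` unit_ball X"
    by (auto simp: unit_ball_def img n)
  have "vnorm (dual X) (?F f) = vnorm (dual Y) f" for f
  proof -
    have "(\<lambda>x. cmod (?F f x)) ` unit_ball X = (\<lambda>y. cmod (f y)) ` unit_ball Y"
      unfolding ball image_image by (rule image_cong) (auto simp: unit_ball_def)
    then show ?thesis by (simp add: dual_def)
  qed
  then show ?thesis
    unfolding isometric_isomorphism_def
    using bij by (auto simp: dual_def fun_eq_iff img)
qed

definition transport :: "('a \<Rightarrow> 'b) \<Rightarrow> 'a nspace \<Rightarrow> 'b nspace" where
  "transport g X =
     \<lparr> carrier = g ` carrier X, monoid.mult = undefined, one = undefined, zero = g \<zero>\<^bsub>X\<^esub>,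
       add = (\<lambda>x y. g (inv_into UNIV g x \<oplus>\<^bsub>X\<^esub> inv_into UNIV g y)), smult = (\<lambda>c x. g (c \<odot>\<^bsub>X\<^esub> inv_into UNIV g x)),
       vnorm = (\<lambda>x. vnorm X (inv_into UNIV g x)) \<rparr>"

lemma iso_transport: "inj g \<Longrightarrow> isometric_isomorphism X (transport g X) g"
  by (auto simp: isometric_isomorphism_def transport_def bij_betw_def inj_on_def)

lemma dual_tower_Suc:
  fixes X :: "('a, 'm) nspace_scheme" and D :: "nat \<Rightarrow> 'u nspace"
  assumes X: "complex_normed_space X" and tower: "dual_tower X m D \<iota> T"
  shows "\<exists>(D' :: nat \<Rightarrow> ('u + ('u \<Rightarrow> complex)) nspace) \<iota>' T'. dual_tower X (Suc m) D' \<iota>' T'"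
proof -
  have T: "isometric_isomorphism (dual (D k)) (D (Suc k)) (T k)" if "k < m" for k
    using tower that by (simp add: dual_tower_def)
  have cl: "closed_ops (D k)" if "k \<le> m" for k
    using that
  proof (induction k)
    case 0
    then show ?case
      using tower iso_closed_ops closed_ops_normed[OF X] by (auto simp: dual_tower_def)
  next
    case (Suc k)
    then show ?case
      using iso_closed_ops[OF T closed_ops_dual] by simp
  qed
  define j :: "'u \<Rightarrow> 'u + ('u \<Rightarrow> complex)" where "j = Inl"
  define D' where "D' k = (if k \<le> m then transport j (D k) else transport Inr (dual (D m)))" for k
  have j: "isometric_isomorphism (D k) (D' k) j" if "k \<le> m" for k
    using that by (simp add: D'_def j_def iso_transport)
  have dual: "\<exists>\<psi>. isometric_isomorphism (dual (D' k)) (dual (D k)) \<psi>" if "k \<le> m" for k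
    using iso_dual[OF j[OF that] cl[OF that]] by blast
  have "\<exists>\<phi>. isometric_isomorphism (dual (D' k)) (D' (Suc k)) \<phi>" if k: "k < Suc m" for k
  proof (cases "k = m")
    case True
    have "isometric_isomorphism (dual (D m)) (D' (Suc m)) Inr"
      by (simp add: D'_def iso_transport)
    then show ?thesis using dual[of m] True iso_comp by blast
  next
    case False
    with k have "k < m" by simp
    then show ?thesis
      using dual[of k] iso_comp[OF _ iso_comp[OF T[of k] j[of "Suc k"]]] by fastforce
  qed
  then obtain T' where "\<And>k. k < Suc m \<Longrightarrow> isometric_isomorphism (dual (D' k)) (D' (Suc k)) (T' k)"
    by metis
  moreover have "isometric_isomorphism X (D' 0) (j \<circ> \<iota>)"
    using tower j[of 0] unfolding dual_tower_def by (intro iso_comp) auto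
  ultimately have "dual_tower X (Suc m) D' (j \<circ> \<iota>) T'"
    by (simp add: dual_tower_def)
  then show ?thesis by blast
qed

end

theory Submission
  imports Defs
begin

text \<open>
  Call \<open>x\<close> in the unit ball strongly extreme if \<open>y\<close> tends to \<open>0\<close> whenever the larger of the norms of
  \<open>x + y\<close> and \<open>x - y\<close> tends to \<open>1\<close>. By Hahn--Banach this property, with the same moduli, passes to
  the bidual, hence to all duals of even order; no algebra structure on the biduals is needed. It
  remains to see that an extreme point \<open>x\<close> of the unit ball of a C*-algebra is strongly extreme. As
  Kadison showed, \<open>x\<close> is a partial isometry with \<open>(1 - q) y (1 - p) = 0\<close> for all \<open>y\<close>, where
  \<open>p = x\<^sup>* x\<close> and \<open>q = x x\<^sup>*\<close>. If \<open>x + y\<close> and \<open>x - y\<close> almost lie in the unit ball, then \<open>y p\<close> and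
  \<open>q y\<close> are small, and so is \<open>y = y p + q y (1 - p)\<close>. Of spectral theory only norm estimates for
  polynomials in a self-adjoint element are used, derived from approximate square roots.
\<close>

section \<open>Normed spaces and the Hahn--Banach theorem\<close>

text \<open>In a general Banach space an extreme point of the unit ball need not stay extreme in the
  bidual, so the induction over even duals must carry a quantitative property that does. For
  \<open>F\<close> in the bidual, Goldstine's theorem applied to \<open>x + F\<close> yields
  elements \<open>y\<close> with control of the norm of \<open>x + y\<close> alone. Both norms are
  handled at once by splitting the test functional into a part paired with \<open>x + F\<close> and
  a part paired with \<open>x - F\<close>, see \<open>split_functional\<close>. In the algebra, the
  obstacle is that \<open>h = adj A x \<otimes> x\<close> is at first only known to be self-adjoint,
  not positive. Scalar inequalities must therefore hold on [-1, 1] instead of [0, 1], which is why 1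
  - h^2 is used rather than 1 - h, and the spectral value -1 has to be excluded separately by
  \<open>sum_of_squares_zero\<close>. A bound by 1 for a polynomial b in a self-adjoint element
  comes from a commuting partner d with b^2 + d^2 close to 1, as for cosine and sine. The numerical
  constants are crude; what matters is that the final modulus tends to 0.\<close>

context complex_normed_space
begin

lemma smult_in [simp, intro]: "x \<in> carrier X \<Longrightarrow> c \<odot> x \<in> carrier X"
  by (rule smult_closed) (simp_all add: complex_ring_def)

lemma smult_add: "x \<in> carrier X \<Longrightarrow> y \<in> carrier X \<Longrightarrow> c \<odot> (x \<oplus> y) = c \<odot> x \<oplus> c \<odot> y"
  by (rule smult_r_distr) (simp_all add: complex_ring_def)

lemma add_smult: "x \<in> carrier X \<Longrightarrow> (c + d) \<odot> x = c \<odot> x \<oplus> d \<odot> x"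
  using smult_l_distr[of c d x] by (simp add: complex_ring_def)

lemma smult_smult [simp]: "x \<in> carrier X \<Longrightarrow> c \<odot> (d \<odot> x) = (c * d) \<odot> x"
  using smult_assoc1[of c d x] by (simp add: complex_ring_def)

lemma one_smult [simp]: "x \<in> carrier X \<Longrightarrow> 1 \<odot> x = x"
  using smult_one[of x] by (simp add: complex_ring_def)

lemma zero_smult [simp]: "x \<in> carrier X \<Longrightarrow> 0 \<odot> x = \<zero>"
  using smult_l_null[of x] by (simp add: complex_ring_def)

lemma smult_zero [simp]: "c \<odot> \<zero> = \<zero>"
  using smult_r_null[of c] by (simp add: complex_ring_def)

lemma add_neg [simp]: "x \<in> carrier X \<Longrightarrow> x \<oplus> (-1) \<odot> x = \<zero>"
  using add_smult[of x 1 "-1"] by simp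

lemma a_inv_smult: "x \<in> carrier X \<Longrightarrow> \<ominus> x = (-1) \<odot> x"
  using minus_equality[of "(-1) \<odot> x" x] by (simp add: a_comm)

lemma minus_smult: "x \<in> carrier X \<Longrightarrow> y \<in> carrier X \<Longrightarrow> x \<ominus> y = x \<oplus> (-1) \<odot> y"
  by (simp add: a_minus_def a_inv_smult)

lemma vnorm_zero [simp]: "vnorm X \<zero> = 0"
  by (simp add: vnorm_eq_zero)

lemma vnorm_minus_le:
  "x \<in> carrier X \<Longrightarrow> y \<in> carrier X \<Longrightarrow> vnorm X (x \<ominus> y) \<le> vnorm X x + vnorm X y"
  using vnorm_triangle[of x "(-1) \<odot> y"] by (simp add: minus_smult vnorm_smult)

section \<open>Minimal sublinear functionals\<close>

definition sublinear :: "('a \<Rightarrow> real) \<Rightarrow> bool" where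
  "sublinear p \<longleftrightarrow>
     (\<forall>u\<in>carrier X. \<forall>v\<in>carrier X. p (u \<oplus> v) \<le> p u + p v) \<and>
     (\<forall>r>0. \<forall>u\<in>carrier X. p (complex_of_real r \<odot> u) = r * p u)"

definition real_linear :: "('a \<Rightarrow> real) \<Rightarrow> bool" where
  "real_linear g \<longleftrightarrow>
     (\<forall>u\<in>carrier X. \<forall>v\<in>carrier X. g (u \<oplus> v) = g u + g v) \<and>
     (\<forall>r. \<forall>u\<in>carrier X. g (complex_of_real r \<odot> u) = r * g u)"

lemma sublinearD:
  assumes "sublinear p"
  shows "u \<in> carrier X \<Longrightarrow> v \<in> carrier X \<Longrightarrow> p (u \<oplus> v) \<le> p u + p v"
    and "r > 0 \<Longrightarrow> u \<in> carrier X \<Longrightarrow> p (complex_of_real r \<odot> u) = r * p u"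
  using assms by (auto simp: sublinear_def)

lemma sublinear_zero: "sublinear p \<Longrightarrow> p \<zero> = 0"
  using sublinearD(2)[of p 2 \<zero>] by simp

lemma sublinear_neg: "sublinear p \<Longrightarrow> u \<in> carrier X \<Longrightarrow> - p ((-1) \<odot> u) \<le> p u"
  using sublinearD(1)[of p u "(-1) \<odot> u"] by (simp add: sublinear_zero)

text \<open>For sublinear \<open>p\<close> and \<open>a\<close> in the carrier this is the greatest
  sublinear functional below \<open>p\<close> whose value at \<open>-a\<close> is at most
  \<open>- p a\<close>: subadditivity of any such \<open>q\<close> gives
  \<open>q u \<le> p (u + t a) - t * p a\<close> for all t \<ge> 0. A linear functional below it
  attains \<open>p a\<close> at \<open>a\<close>.\<close>

definition descent :: "('a \<Rightarrow> real) \<Rightarrow> 'a \<Rightarrow> 'a \<Rightarrow> real" where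
  "descent p a u = (INF t\<in>{0..}. p (u \<oplus> complex_of_real t \<odot> a) - t * p a)"

lemma descent:
  assumes p: "sublinear p" and a: "a \<in> carrier X"
  shows descent_le: "\<And>u t. u \<in> carrier X \<Longrightarrow> 0 \<le> t \<Longrightarrow>
            descent p a u \<le> p (u \<oplus> complex_of_real t \<odot> a) - t * p a"
    and sublinear_descent: "sublinear (descent p a)"
proof -
  \<comment> \<open>A lower bound independent of \<open>t\<close>, so that the infimum defining
    \<open>descent\<close> is a genuine one.\<close>
  have low: "- p ((-1) \<odot> u) \<le> p (u \<oplus> complex_of_real t \<odot> a) - t * p a"
    if u: "u \<in> carrier X" and t: "0 \<le> t" for u t
  proof -
    have ta: "p (complex_of_real t \<odot> a) = t * p a"
      using t a sublinearD(2)[OF p, of t a] by (cases "t = 0") (simp_all add: sublinear_zero[OF p])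
    have "complex_of_real t \<odot> a = (-1) \<odot> u \<oplus> (u \<oplus> complex_of_real t \<odot> a)"
      using u a by (simp add: a_assoc[symmetric] a_comm[of "(-1) \<odot> u" u])
    then have "p (complex_of_real t \<odot> a) \<le> p ((-1) \<odot> u) + p (u \<oplus> complex_of_real t \<odot> a)"
      using sublinearD(1)[OF p, of "(-1) \<odot> u" "u \<oplus> complex_of_real t \<odot> a"] u a by simp
    then show ?thesis using ta by simp
  qed
  show le: "descent p a u \<le> p (u \<oplus> complex_of_real t \<odot> a) - t * p a"
    if "u \<in> carrier X" "0 \<le> t" for u t
    unfolding descent_def using that low[of u]
    by (intro cINF_lower) (auto intro!: bdd_belowI2[where m = "- p ((-1) \<odot> u)"])
  have ge: "m \<le> descent p a u"
    if "\<And>t. 0 \<le> t \<Longrightarrow> m \<le> p (u \<oplus> complex_of_real t \<odot> a) - t * p a" for m u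
    unfolding descent_def using that by (intro cINF_greatest) auto
  show "sublinear (descent p a)"
    unfolding sublinear_def
  proof (intro conjI ballI allI impI)
    fix u v assume u: "u \<in> carrier X" and v: "v \<in> carrier X"
    have *: "descent p a (u \<oplus> v) \<le> (p (u \<oplus> complex_of_real t \<odot> a) - t * p a) +
        (p (v \<oplus> complex_of_real s \<odot> a) - s * p a)" if "0 \<le> t" "0 \<le> s" for t s
    proof -
      have "(u \<oplus> v) \<oplus> complex_of_real (t + s) \<odot> a =
          (u \<oplus> complex_of_real t \<odot> a) \<oplus> (v \<oplus> complex_of_real s \<odot> a)"
        using u v a by (simp add: add_smult a_ac)
      then have "p ((u \<oplus> v) \<oplus> complex_of_real (t + s) \<odot> a) \<le>
          p (u \<oplus> complex_of_real t \<odot> a) + p (v \<oplus> complex_of_real s \<odot> a)"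
        using sublinearD(1)[OF p] u v a by simp
      then show ?thesis
        using le[of "u \<oplus> v" "t + s"] u v that by (simp add: algebra_simps)
    qed
    have "descent p a (u \<oplus> v) - (p (v \<oplus> complex_of_real s \<odot> a) - s * p a) \<le> descent p a u"
      if "0 \<le> s" for s
      using *[OF _ that] by (intro ge) (simp add: algebra_simps)
    then have "descent p a (u \<oplus> v) - descent p a u \<le> descent p a v"
      by (intro ge) (simp add: algebra_simps)
    then show "descent p a (u \<oplus> v) \<le> descent p a u + descent p a v" by simp
  next
    fix r :: real and u assume r: "r > 0" and u: "u \<in> carrier X"
    have *: "p (complex_of_real r \<odot> u \<oplus> complex_of_real (r * t) \<odot> a) - r * t * p a =
        r * (p (u \<oplus> complex_of_real t \<odot> a) - t * p a)" for t
    proof -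
      have "complex_of_real r \<odot> u \<oplus> complex_of_real (r * t) \<odot> a =
          complex_of_real r \<odot> (u \<oplus> complex_of_real t \<odot> a)"
        using u a by (simp add: smult_add)
      then show ?thesis
        using sublinearD(2)[OF p r, of "u \<oplus> complex_of_real t \<odot> a"] u a
        by (simp add: algebra_simps)
    qed
    show "descent p a (complex_of_real r \<odot> u) = r * descent p a u"
    proof (rule antisym)
      have "descent p a (complex_of_real r \<odot> u) / r \<le> descent p a u"
      proof (rule ge)
        fix t :: real assume "0 \<le> t"
        then show "descent p a (complex_of_real r \<odot> u) / r \<le>
            p (u \<oplus> complex_of_real t \<odot> a) - t * p a"
          using le[of "complex_of_real r \<odot> u" "r * t"] *[of t] r u
          by (simp add: divide_le_eq mult.commute)
      qed
      then show "descent p a (complex_of_real r \<odot> u) \<le> r * descent p a u"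
        using r by (simp add: divide_le_eq mult.commute)
    next
      show "r * descent p a u \<le> descent p a (complex_of_real r \<odot> u)"
      proof (rule ge)
        fix t :: real assume t: "0 \<le> t"
        have "r * descent p a u \<le> r * (p (u \<oplus> complex_of_real (t / r) \<odot> a) - t / r * p a)"
          using le[of u "t / r"] t r u by (intro mult_left_mono) auto
        then show "r * descent p a u \<le>
            p (complex_of_real r \<odot> u \<oplus> complex_of_real t \<odot> a) - t * p a"
          using *[of "t / r"] r by simp
      qed
    qed
  qed
qed

lemma chain_lower_bound:
  assumes ne: "C \<noteq> {}"
    and sub: "\<And>q. q \<in> C \<Longrightarrow> sublinear q"
    and le: "\<And>q u. q \<in> C \<Longrightarrow> u \<in> carrier X \<Longrightarrow> q u \<le> p u"
    and chain: "\<And>q q'. q \<in> C \<Longrightarrow> q' \<in> C \<Longrightarrow>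
      (\<forall>u\<in>carrier X. q u \<le> q' u) \<or> (\<forall>u\<in>carrier X. q' u \<le> q u)"
  shows "sublinear (\<lambda>u. INF q\<in>C. q u)"
    and "\<And>q u. q \<in> C \<Longrightarrow> u \<in> carrier X \<Longrightarrow> (INF q\<in>C. q u) \<le> q u"
proof -
  let ?i = "\<lambda>u. INF q\<in>C. q u"
  have bdd: "bdd_below ((\<lambda>q. q u) ` C)" if u: "u \<in> carrier X" for u
  proof (rule bdd_belowI2)
    fix q assume q: "q \<in> C"
    then show "- p ((-1) \<odot> u) \<le> q u"
      using sublinear_neg[OF sub[OF q] u] le[OF q, of "(-1) \<odot> u"] u by simp
  qed
  show i: "?i u \<le> q u" if "q \<in> C" "u \<in> carrier X" for q u
    using that bdd by (intro cINF_lower) auto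
  have ge: "m \<le> ?i u" if "\<And>q. q \<in> C \<Longrightarrow> m \<le> q u" for m u
    using ne that by (intro cINF_greatest) auto
  show "sublinear ?i"
    unfolding sublinear_def
  proof (intro conjI ballI allI impI)
    fix u v assume u: "u \<in> carrier X" and v: "v \<in> carrier X"
    \<comment> \<open>Here the chain property is essential: the smaller of \<open>q\<close> and
      \<open>q'\<close> is subadditive and lies below both, so it alone bounds the infimum by the
      mixed sum.\<close>
    have *: "?i (u \<oplus> v) \<le> q u + q' v" if "q \<in> C" "q' \<in> C" for q q'
      using chain[OF that] sublinearD(1)[OF sub u v] i[OF that(1), of "u \<oplus> v"]
        i[OF that(2), of "u \<oplus> v"] u v that by force
    have "?i (u \<oplus> v) - q' v \<le> ?i u" if "q' \<in> C" for q'
      using *[OF _ that] by (intro ge) (simp add: algebra_simps)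
    then have "?i (u \<oplus> v) - ?i u \<le> ?i v"
      by (intro ge) (simp add: algebra_simps)
    then show "?i (u \<oplus> v) \<le> ?i u + ?i v" by simp
  next
    fix r :: real and u assume r: "r > 0" and u: "u \<in> carrier X"
    show "?i (complex_of_real r \<odot> u) = r * ?i u"
    proof (rule antisym)
      have "?i (complex_of_real r \<odot> u) / r \<le> ?i u"
      proof (rule ge)
        fix q assume q: "q \<in> C"
        then show "?i (complex_of_real r \<odot> u) / r \<le> q u"
          using i[OF q, of "complex_of_real r \<odot> u"] sublinearD(2)[OF sub[OF q] r u] r u
          by (simp add: divide_le_eq mult.commute)
      qed
      then show "?i (complex_of_real r \<odot> u) \<le> r * ?i u"
        using r by (simp add: divide_le_eq mult.commute)
    next
      show "r * ?i u \<le> ?i (complex_of_real r \<odot> u)"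
      proof (rule ge)
        fix q assume q: "q \<in> C"
        then show "r * ?i u \<le> q (complex_of_real r \<odot> u)"
          using i[OF q u] sublinearD(2)[OF sub[OF q] r u] r by simp
      qed
    qed
  qed
qed

text \<open>A minimal sublinear functional equals its own descents, which makes it additive.\<close>

theorem hahn_banach:
  assumes p: "sublinear p"
  obtains g where "real_linear g" "\<And>u. u \<in> carrier X \<Longrightarrow> g u \<le> p u"
proof -
  \<comment> \<open>Extensionality makes the pointwise order antisymmetric; \<open>P\<close> is that
    order reversed, so that Zorn's lemma yields a minimal element.\<close>
  define S where "S = {q \<in> extensional (carrier X). sublinear q \<and> (\<forall>u\<in>carrier X. q u \<le> p u)}"
  define P where "P q q' \<longleftrightarrow> (\<forall>u\<in>carrier X. q' u \<le> q u)" for q q' :: "'a \<Rightarrow> real"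
  have restr: "sublinear (restrict q (carrier X)) \<longleftrightarrow> sublinear q" for q
    by (simp add: sublinear_def)
  have po: "partial_order_on S (relation_of P S)"
  proof (rule partial_order_on_relation_ofI)
    fix q q' assume "q \<in> S" "q' \<in> S" "P q q'" "P q' q"
    then show "q = q'"
      by (intro extensionalityI[of _ "carrier X"]) (auto simp: P_def S_def intro: order.antisym)
  qed (auto simp: P_def intro: order_trans)
  obtain g where g: "g \<in> S" and min: "\<And>q. q \<in> S \<Longrightarrow> P g q \<Longrightarrow> q = g"
  proof -
    have "\<exists>q\<in>S. \<forall>q'\<in>C. P q' q" if C: "C \<in> Chains (relation_of P S)" for C
    proof -
      have CS: "C \<subseteq> S" using C by (auto simp: Chains_def relation_of_def)
      show ?thesis
      proof (cases "C = {}")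
        case True
        have "restrict p (carrier X) \<in> S"
          using p by (simp add: S_def restr)
        then show ?thesis using True by blast
      next
        case False
        have chain: "(\<forall>u\<in>carrier X. q u \<le> q' u) \<or> (\<forall>u\<in>carrier X. q' u \<le> q u)"
          if "q \<in> C" "q' \<in> C" for q q'
          using C that by (auto simp: Chains_def relation_of_def P_def)
        let ?q = "\<lambda>u. INF q\<in>C. q u"
        have C: "\<And>q. q \<in> C \<Longrightarrow> sublinear q" "\<And>q u. q \<in> C \<Longrightarrow> u \<in> carrier X \<Longrightarrow> q u \<le> p u"
          using CS by (auto simp: S_def)
        have sub: "sublinear ?q"
          by (rule chain_lower_bound(1)[where p = p]) (fact False C chain)+
        have low: "?q u \<le> q u" if "q \<in> C" "u \<in> carrier X" for q u
          by (rule chain_lower_bound(2)[where p = p]) (fact False C chain that)+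
        have "?q u \<le> p u" if "u \<in> carrier X" for u
          using False low[OF _ that] CS that by (fastforce simp: S_def)
        then have "restrict ?q (carrier X) \<in> S"
          using sub by (simp add: S_def restr)
        then show ?thesis using low by (auto simp: P_def intro!: bexI[of _ "restrict ?q (carrier X)"])
      qed
    qed
    then show ?thesis using predicate_Zorn[OF po] that by blast
  qed
  have sub: "sublinear g" and gp: "\<And>u. u \<in> carrier X \<Longrightarrow> g u \<le> p u"
    using g by (auto simp: S_def)
  have add: "g (u \<oplus> a) = g u + g a" if u: "u \<in> carrier X" and a: "a \<in> carrier X" for u a
  proof -
    let ?d = "restrict (descent g a) (carrier X)"
    have dle: "?d v \<le> g v" if "v \<in> carrier X" for v
      using descent_le[OF sub a that, of 0] that a by simp
    then have "?d \<in> S"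
      using sublinear_descent[OF sub a] gp by (auto simp: S_def restr intro: order_trans)
    then have "?d = g" using min dle by (auto simp: P_def)
    then have "g u \<le> g (u \<oplus> a) - g a"
      using descent_le[OF sub a u, of 1] u a by (metis mult_1 of_real_1 one_smult restrict_apply' zero_le_one)
    then show ?thesis using sublinearD(1)[OF sub u a] by simp
  qed
  have neg: "g ((-1) \<odot> u) = - g u" if "u \<in> carrier X" for u
    using add[of u "(-1) \<odot> u"] that sublinear_zero[OF sub] by simp
  have "g (complex_of_real r \<odot> u) = r * g u" if u: "u \<in> carrier X" for r u
  proof (cases r "0 :: real" rule: linorder_cases)
    case less
    then have "g (complex_of_real (- r) \<odot> u) = - r * g u"
      using sublinearD(2)[OF sub, of "- r" u] u by simp
    then show ?thesis using neg[of "complex_of_real (- r) \<odot> u"] u by simp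
  next
    case greater
    then show ?thesis using sublinearD(2)[OF sub, of r u] u by simp
  qed (use u sublinear_zero[OF sub] in simp)
  then have "real_linear g" using add by (simp add: real_linear_def)
  then show ?thesis using that gp by blast
qed

end

section \<open>Duals\<close>

context complex_normed_space
begin

lemma zero_in_unit_ball: "\<zero> \<in> unit_ball X"
  by (simp add: unit_ball_def)

lemma dual_iff: "f \<in> carrier (dual X) \<longleftrightarrow> f \<in> extensional (carrier X) \<and> bounded_functional X f"
  by (simp add: dual_def)

lemma dual_linear:
  assumes "f \<in> carrier (dual X)"
  shows "u \<in> carrier X \<Longrightarrow> v \<in> carrier X \<Longrightarrow> f (u \<oplus> v) = f u + f v"
    and "u \<in> carrier X \<Longrightarrow> f (c \<odot> u) = c * f u"
    and "f \<zero> = 0"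
proof -
  show 1: "u \<in> carrier X \<Longrightarrow> f (c \<odot> u) = c * f u" for u c
    using assms by (simp add: dual_iff bounded_functional_def)
  show "u \<in> carrier X \<Longrightarrow> v \<in> carrier X \<Longrightarrow> f (u \<oplus> v) = f u + f v"
    using assms by (simp add: dual_iff bounded_functional_def)
  show "f \<zero> = 0" using 1[of \<zero> 0] by simp
qed

lemma vnorm_dual_le: "(\<And>u. u \<in> unit_ball X \<Longrightarrow> cmod (f u) \<le> M) \<Longrightarrow> vnorm (dual X) f \<le> M"
  unfolding dual_def using zero_in_unit_ball by (auto intro!: cSUP_least)

lemma unit_ball_dual:
  assumes f: "f \<in> carrier (dual X)" and u: "u \<in> unit_ball X"
  shows "cmod (f u) \<le> vnorm (dual X) f"
proof -
  obtain K where K: "\<And>x. x \<in> carrier X \<Longrightarrow> cmod (f x) \<le> K * vnorm X x"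
    using f unfolding dual_iff bounded_functional_def by blast
  have "cmod (f x) \<le> \<bar>K\<bar>" if "x \<in> unit_ball X" for x
  proof -
    have "K * vnorm X x \<le> \<bar>K\<bar> * 1"
      using that vnorm_nonneg[of x] by (intro mult_mono) (auto simp: unit_ball_def)
    then show ?thesis using K[of x] that by (simp add: unit_ball_def)
  qed
  then have "bdd_above ((\<lambda>x. cmod (f x)) ` unit_ball X)"
    by (intro bdd_aboveI2)
  then show ?thesis
    unfolding dual_def using u by (auto intro: cSUP_upper)
qed

lemma normalize:
  assumes "u \<in> carrier X" "u \<noteq> \<zero>"
  shows "complex_of_real (1 / vnorm X u) \<odot> u \<in> unit_ball X"
  using assms vnorm_nonneg[of u] vnorm_eq_zero[of u]
  by (simp add: unit_ball_def vnorm_smult norm_divide)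

lemma vnorm_dual:
  assumes f: "f \<in> carrier (dual X)" and u: "u \<in> carrier X"
  shows "cmod (f u) \<le> vnorm (dual X) f * vnorm X u"
proof (cases "u = \<zero>")
  case False
  then have n: "vnorm X u > 0" using u vnorm_nonneg[of u] vnorm_eq_zero[of u] by simp
  have "cmod (f (complex_of_real (1 / vnorm X u) \<odot> u)) \<le> vnorm (dual X) f"
    using unit_ball_dual[OF f normalize[OF u False]] .
  then show ?thesis
    using n u by (simp add: dual_linear[OF f] norm_mult norm_divide divide_le_eq)
qed (simp add: dual_linear[OF f])

lemma vnorm_dual_nonneg: "f \<in> carrier (dual X) \<Longrightarrow> 0 \<le> vnorm (dual X) f"
  using unit_ball_dual[OF _ zero_in_unit_ball] norm_ge_zero order_trans by blast

lemma complex_normed_space_dual: "complex_normed_space (dual X)"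
proof -
  have "closed_ops X"
    by (rule closed_ops_normed) unfold_locales
  then have cl: "closed_ops (dual X)" by (rule closed_ops_dual)
  then have z: "\<zero>\<^bsub>dual X\<^esub> \<in> carrier (dual X)"
    and a: "\<And>f g. f \<in> carrier (dual X) \<Longrightarrow> g \<in> carrier (dual X) \<Longrightarrow> f \<oplus>\<^bsub>dual X\<^esub> g \<in> carrier (dual X)"
    and s: "\<And>c f. f \<in> carrier (dual X) \<Longrightarrow> c \<odot>\<^bsub>dual X\<^esub> f \<in> carrier (dual X)"
    by (auto simp: closed_ops_def)
  have zd: "\<zero>\<^bsub>dual X\<^esub> = (\<lambda>x\<in>carrier X. 0)"
    and ad: "\<And>f g. f \<oplus>\<^bsub>dual X\<^esub> g = (\<lambda>x\<in>carrier X. f x + g x)"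
    and sd: "\<And>c f. c \<odot>\<^bsub>dual X\<^esub> f = (\<lambda>x\<in>carrier X. c * f x)"
    by (simp_all add: dual_def)
  have restr: "(\<lambda>x\<in>carrier X. f x) = f" if "f \<in> carrier (dual X)" for f
    using that by (simp add: dual_iff extensional_restrict)
  have ext: "f = g" if "f \<in> carrier (dual X)" "g \<in> carrier (dual X)"
      "\<And>x. x \<in> carrier X \<Longrightarrow> f x = g x" for f g
    using that by (auto simp: dual_iff intro: extensionalityI)
  have ab: "abelian_group (dual X)"
  proof (rule abelian_groupI)
    fix f assume f: "f \<in> carrier (dual X)"
    show "\<exists>g\<in>carrier (dual X). g \<oplus>\<^bsub>dual X\<^esub> f = \<zero>\<^bsub>dual X\<^esub>"
      by (rule bexI[OF _ s[OF f, of "-1"]]) (simp add: zd ad sd cong: restrict_cong)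
    show "\<zero>\<^bsub>dual X\<^esub> \<oplus>\<^bsub>dual X\<^esub> f = f"
      by (simp add: zd ad restr[OF f] cong: restrict_cong)
  qed (auto simp: a z, auto simp: ad algebra_simps cong: restrict_cong)
  have md: "module complex_ring (dual X)"
  proof (rule moduleI)
    show "cring complex_ring" by (rule R.is_cring)
  qed (use ab s in \<open>auto simp: complex_ring_def\<close>, 
      auto simp: ad sd restr algebra_simps cong: restrict_cong)
  interpret D: module complex_ring "dual X" by (rule md)
  show ?thesis
  proof
    fix f assume f: "f \<in> carrier (dual X)"
    show "0 \<le> vnorm (dual X) f" by (rule vnorm_dual_nonneg[OF f])
    show "vnorm (dual X) f = 0 \<longleftrightarrow> f = \<zero>\<^bsub>dual X\<^esub>"
    proof
      assume "vnorm (dual X) f = 0"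
      then show "f = \<zero>\<^bsub>dual X\<^esub>"
        using vnorm_dual[OF f] by (intro ext[OF f z]) (simp add: zd)
    next
      assume "f = \<zero>\<^bsub>dual X\<^esub>"
      then have "vnorm (dual X) f \<le> 0"
        by (intro vnorm_dual_le) (simp add: zd unit_ball_def)
      then show "vnorm (dual X) f = 0" using vnorm_dual_nonneg[OF f] by simp
    qed
    have le: "vnorm (dual X) (c \<odot>\<^bsub>dual X\<^esub> g) \<le> cmod c * vnorm (dual X) g"
      if g: "g \<in> carrier (dual X)" for c g
      using unit_ball_dual[OF g]
      by (intro vnorm_dual_le) (auto simp: sd unit_ball_def norm_mult intro!: mult_left_mono)
    show "vnorm (dual X) (c \<odot>\<^bsub>dual X\<^esub> f) = cmod c * vnorm (dual X) f" for c
    proof (cases "c = 0")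
      case True
      then show ?thesis using le[OF f, of 0] vnorm_dual_nonneg[OF s[OF f, of 0]] by simp
    next
      case False
      have "inverse c \<odot>\<^bsub>dual X\<^esub> (c \<odot>\<^bsub>dual X\<^esub> f) = f"
        using False by (simp add: sd restr[OF f] mult.assoc[symmetric] cong: restrict_cong)
      then have "vnorm (dual X) f \<le> cmod (inverse c) * vnorm (dual X) (c \<odot>\<^bsub>dual X\<^esub> f)"
        using le[OF s[OF f, of c], of "inverse c"] by simp
      then have "cmod c * vnorm (dual X) f \<le> vnorm (dual X) (c \<odot>\<^bsub>dual X\<^esub> f)"
        using False by (simp add: norm_divide field_simps)
      then show ?thesis using le[OF f, of c] by simp
    qed
    fix g assume g: "g \<in> carrier (dual X)"
    show "vnorm (dual X) (f \<oplus>\<^bsub>dual X\<^esub> g) \<le> vnorm (dual X) f + vnorm (dual X) g"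
    proof (rule vnorm_dual_le)
      fix u assume u: "u \<in> unit_ball X"
      show "cmod ((f \<oplus>\<^bsub>dual X\<^esub> g) u) \<le> vnorm (dual X) f + vnorm (dual X) g"
        using unit_ball_dual[OF f u] unit_ball_dual[OF g u] u norm_triangle_ineq[of "f u" "g u"]
        by (simp add: ad unit_ball_def)
    qed
  qed
qed

lemma canonical_embedding_in_bidual:
  assumes x: "x \<in> carrier X"
  shows "canonical_embedding X x \<in> carrier (bidual X)"
    and "vnorm (bidual X) (canonical_embedding X x) \<le> vnorm X x"
proof -
  interpret D: complex_normed_space "dual X" by (rule complex_normed_space_dual)
  show "canonical_embedding X x \<in> carrier (bidual X)"
    unfolding D.dual_iff bounded_functional_def
  proof (intro conjI ballI allI exI)
    fix f g c assume f: "f \<in> carrier (dual X)" and g: "g \<in> carrier (dual X)"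
    show "canonical_embedding X x (f \<oplus>\<^bsub>dual X\<^esub> g) =
        canonical_embedding X x f + canonical_embedding X x g"
      using D.a_closed[OF f g] f g x by (simp add: canonical_embedding_def) (simp add: dual_def)
    show "canonical_embedding X x (c \<odot>\<^bsub>dual X\<^esub> f) = c * canonical_embedding X x f"
      using D.smult_in[OF f, of c] f x by (simp add: canonical_embedding_def) (simp add: dual_def)
    show "cmod (canonical_embedding X x f) \<le> vnorm X x * vnorm (dual X) f"
      using vnorm_dual[OF f x] f by (simp add: canonical_embedding_def mult.commute)
  qed (simp add: canonical_embedding_def)
  show "vnorm (bidual X) (canonical_embedding X x) \<le> vnorm X x"
  proof (rule D.vnorm_dual_le)
    fix f assume f: "f \<in> unit_ball (dual X)"
    then have "vnorm (dual X) f * vnorm X x \<le> 1 * vnorm X x"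
      using vnorm_nonneg[OF x] by (intro mult_right_mono) (auto simp: unit_ball_def)
    then show "cmod (canonical_embedding X x f) \<le> vnorm X x"
      using vnorm_dual[of f x] f x by (simp add: canonical_embedding_def unit_ball_def)
  qed
qed

text \<open>For real-linear \<open>g\<close> this is the complex-linear functional on the carrier
  with real part \<open>g\<close>; its imaginary part is forced by Im f(u) = - Re f(i u).\<close>

definition complexify :: "('a \<Rightarrow> real) \<Rightarrow> 'a \<Rightarrow> complex" where
  "complexify g = (\<lambda>u\<in>carrier X. Complex (g u) (- g (\<i> \<odot> u)))"

lemma Re_complexify [simp]: "u \<in> carrier X \<Longrightarrow> Re (complexify g u) = g u"
  by (simp add: complexify_def)

lemma complexify_linear:
  assumes g: "real_linear g" and u: "u \<in> carrier X"
  shows "v \<in> carrier X \<Longrightarrow> complexify g (u \<oplus> v) = complexify g u + complexify g v"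
    and "complexify g (c \<odot> u) = c * complexify g u"
proof -
  have add: "\<And>u v. u \<in> carrier X \<Longrightarrow> v \<in> carrier X \<Longrightarrow> g (u \<oplus> v) = g u + g v"
    and sm: "\<And>r u. u \<in> carrier X \<Longrightarrow> g (complex_of_real r \<odot> u) = r * g u"
    using g by (auto simp: real_linear_def)
  have rot: "g (c \<odot> w) = Re c * g w + Im c * g (\<i> \<odot> w)" if "w \<in> carrier X" for c w
  proof -
    have "c \<odot> w = complex_of_real (Re c) \<odot> w \<oplus> complex_of_real (Im c) \<odot> (\<i> \<odot> w)"
      using that by (simp add: add_smult[symmetric] complex_eq[symmetric] mult.commute)
    then show ?thesis using add sm[of w] sm[of "\<i> \<odot> w" "Im c"] that by simp
  qed
  show "complexify g (u \<oplus> v) = complexify g u + complexify g v" if v: "v \<in> carrier X"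
    using u v by (simp add: complexify_def smult_add add complex_eq_iff)
  show "complexify g (c \<odot> u) = c * complexify g u"
    using u rot[of u "\<i> * c"] rot[of u c]
    by (simp add: complexify_def complex_eq_iff algebra_simps)
qed

text \<open>Turns bounds on real parts into bounds on absolute values, over sets closed under
  multiplication by unimodular scalars.\<close>

lemma rotate_to_real:
  obtains c where "cmod c = 1" "c * z = complex_of_real (cmod z)"
proof (cases "z = 0")
  case False
  then show ?thesis
    by (intro that[of "cnj z / complex_of_real (cmod z)"])
      (auto simp: norm_divide complex_norm_square[symmetric] power2_eq_square mult.commute)
qed (use that[of 1] in simp)

lemma complexify_bound:
  assumes g: "real_linear g" and u: "u \<in> carrier X" and le: "\<And>v. v \<in> carrier X \<Longrightarrow> g v \<le> K * vnorm X v"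
  shows "cmod (complexify g u) \<le> K * vnorm X u"
proof -
  obtain c where c: "cmod c = 1" "c * complexify g u = complex_of_real (cmod (complexify g u))"
    using rotate_to_real .
  have "cmod (complexify g u) = Re (complexify g (c \<odot> u))"
    using c complexify_linear(2)[OF g u, of c] by simp
  then show ?thesis using le[of "c \<odot> u"] u c by (simp add: vnorm_smult)
qed

lemma complexify_in_dual:
  assumes "real_linear g" "\<And>v. v \<in> carrier X \<Longrightarrow> g v \<le> K * vnorm X v"
  shows "complexify g \<in> carrier (dual X)"
proof -
  have "complexify g \<in> extensional (carrier X)" by (simp add: complexify_def)
  then show ?thesis
    unfolding dual_iff bounded_functional_def
    using complexify_linear[OF assms(1)] complexify_bound[OF assms(1) _ assms(2)]
    by (auto intro!: exI[of _ K])
qed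

text \<open>Instead of extending a functional from the line through \<open>x\<close>,
  \<open>hahn_banach\<close> is applied to the descent of the norm along \<open>x\<close>. This
  forces g(-x) to be at most minus the norm of \<open>x\<close>, so the real part at
  \<open>x\<close> is positive.\<close>

lemma separate_from_zero:
  assumes x: "x \<in> carrier X" and ne: "x \<noteq> \<zero>"
  obtains f where "f \<in> carrier (dual X)" "f x \<noteq> 0"
proof -
  have n: "sublinear (vnorm X)"
    using vnorm_triangle by (auto simp: sublinear_def vnorm_smult)
  have pos: "vnorm X x > 0" using assms vnorm_nonneg[OF x] vnorm_eq_zero[OF x] by simp
  obtain g where g: "real_linear g" and le: "\<And>u. u \<in> carrier X \<Longrightarrow> g u \<le> descent (vnorm X) x u"
    using hahn_banach[OF sublinear_descent[OF n x]] by blast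
  have "g u \<le> 1 * vnorm X u" if "u \<in> carrier X" for u
    using le[OF that] descent_le[OF n x that, of 0] that x by simp
  then have "complexify g \<in> carrier (dual X)" by (rule complexify_in_dual[OF g])
  moreover have "g ((-1) \<odot> x) \<le> - vnorm X x"
    using le[of "(-1) \<odot> x"] descent_le[OF n x, of "(-1) \<odot> x" 1] x
    by (simp add: a_comm[of "(-1) \<odot> x" x])
  moreover have "g ((-1) \<odot> x) = - g x"
    using g x unfolding real_linear_def by (metis of_real_1 of_real_minus mult_minus1)
  ultimately show ?thesis using that[of "complexify g"] pos x
    by (metis Re_complexify leD neg_0_less_iff_less neg_le_iff_le zero_complex.sel(1))
qed

end

section \<open>Strongly extreme points\<close>

definition strongly_extreme_point :: "('a, 'm) nspace_scheme \<Rightarrow> 'a \<Rightarrow> bool" where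
  "strongly_extreme_point X x \<longleftrightarrow> x \<in> unit_ball X \<and>
     (\<forall>\<epsilon>>0. \<exists>\<delta>>0. \<forall>y\<in>carrier X.
        vnorm X (x \<oplus>\<^bsub>X\<^esub> y) \<le> 1 + \<delta> \<and> vnorm X (x \<oplus>\<^bsub>X\<^esub> (-1) \<odot>\<^bsub>X\<^esub> y) \<le> 1 + \<delta> \<longrightarrow>
        vnorm X y \<le> \<epsilon>)"

context complex_normed_space
begin

lemma strongly_extreme_imp_linear_extreme:
  assumes x: "strongly_extreme_point X x"
  shows "linear_extreme_point X (unit_ball X) x"
  unfolding linear_extreme_point_def
proof (intro conjI ballI allI impI)
  show "x \<in> unit_ball X" using x by (simp add: strongly_extreme_point_def)
  fix a b and t :: real
  assume a: "a \<in> unit_ball X" and b: "b \<in> unit_ball X"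
    and *: "0 < t \<and> t < 1 \<and>
      x = complex_of_real (1 - t) \<odot> a \<oplus> complex_of_real t \<odot> b"
  have ab: "a \<in> carrier X" "b \<in> carrier X" using a b by (auto simp: unit_ball_def)
  \<comment> \<open>The largest step for which both \<open>x + m (b - a)\<close> and
    \<open>x - m (b - a)\<close> are sure to stay on the segment from \<open>a\<close> to
    \<open>b\<close>, hence in the unit ball.\<close>
  define m where "m = min t (1 - t)"
  have m: "0 < m" "m \<le> t" "m \<le> 1 - t" using * by (auto simp: m_def)
  define y where "y = complex_of_real m \<odot> (b \<oplus> (-1) \<odot> a)"
  have y: "y \<in> carrier X" using ab by (simp add: y_def)
  have convex: "vnorm X (complex_of_real r \<odot> a \<oplus> complex_of_real s \<odot> b) \<le> 1"
    if "0 \<le> r" "0 \<le> s" "r + s = 1" for r s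
  proof -
    have "vnorm X (complex_of_real r \<odot> a \<oplus> complex_of_real s \<odot> b) \<le> r * vnorm X a + s * vnorm X b"
      using vnorm_triangle[of "complex_of_real r \<odot> a" "complex_of_real s \<odot> b"] ab that
      by (simp add: vnorm_smult)
    also have "\<dots> \<le> r * 1 + s * 1"
      using a b that by (intro add_mono mult_left_mono) (auto simp: unit_ball_def)
    finally show ?thesis using that by simp
  qed
  have eq: "x \<oplus> complex_of_real k \<odot> y =
      complex_of_real (1 - t - k * m) \<odot> a \<oplus> complex_of_real (t + k * m) \<odot> b" for k
  proof -
    have "complex_of_real (1 - t - k * m) \<odot> a =
        complex_of_real (1 - t) \<odot> a \<oplus> complex_of_real (- k * m) \<odot> a"
      "complex_of_real (t + k * m) \<odot> b = complex_of_real t \<odot> b \<oplus> complex_of_real (k * m) \<odot> b"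
      using ab by (simp_all add: add_smult[symmetric])
    then show ?thesis using * ab by (simp add: y_def smult_add a_ac)
  qed
  have plus: "vnorm X (x \<oplus> y) \<le> 1"
    using eq[of 1] convex[of "1 - t - m" "t + m"] m * y by simp
  have minus: "vnorm X (x \<oplus> (-1) \<odot> y) \<le> 1"
    using eq[of "-1"] convex[of "1 - t + m" "t - m"] m * y by simp
  have "vnorm X y \<le> \<epsilon>" if "\<epsilon> > 0" for \<epsilon>
  proof -
    obtain \<delta> where "\<delta> > 0" and \<delta>: "\<forall>y\<in>carrier X.
        vnorm X (x \<oplus> y) \<le> 1 + \<delta> \<and> vnorm X (x \<oplus> (-1) \<odot> y) \<le> 1 + \<delta> \<longrightarrow> vnorm X y \<le> \<epsilon>"
      using x \<open>\<epsilon> > 0\<close> unfolding strongly_extreme_point_def by blast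
    show ?thesis using \<delta>[rule_format, OF y] plus minus \<open>\<delta> > 0\<close> by simp
  qed
  then have "vnorm X y \<le> 0" by (rule field_le_epsilon[of _ 0, simplified])
  then have "m * vnorm X (b \<oplus> (-1) \<odot> a) = 0"
    using vnorm_nonneg[OF y] ab m by (simp add: y_def vnorm_smult)
  then have z: "b \<oplus> (-1) \<odot> a = \<zero>" using m ab vnorm_eq_zero[of "b \<oplus> (-1) \<odot> a"] by simp
  have "b \<oplus> (-1) \<odot> a \<oplus> a = b" using ab by (simp add: a_assoc a_comm[of "(-1) \<odot> a" a])
  then show "a = b" using z ab by simp
qed

text \<open>
  This is the duality between the support function of the intersection of the two balls
  \<open>{y. vnorm X (x \<oplus> y) \<le> c}\<close> and \<open>{y. vnorm X (x \<ominus> y) \<le> c}\<close> and their separate support functions.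
\<close>

lemma split_functional:
  assumes x: "x \<in> unit_ball X" and f: "f \<in> carrier (dual X)" and c: "1 < c" and \<epsilon>: "0 < \<epsilon>"
    and bound: "\<And>y. y \<in> carrier X \<Longrightarrow> vnorm X (x \<oplus> y) \<le> c \<Longrightarrow> vnorm X (x \<oplus> (-1) \<odot> y) \<le> c
      \<Longrightarrow> Re (f y) \<le> \<epsilon>"
  obtains g h where "g \<in> carrier (dual X)" "h \<in> carrier (dual X)" "f = g \<oplus>\<^bsub>dual X\<^esub> h"
    "c * vnorm (dual X) g - Re (g x) + (c * vnorm (dual X) h + Re (h x)) \<le> \<epsilon>"
proof -
  have xc: "x \<in> carrier X" and x1: "vnorm X x \<le> 1" using x by (auto simp: unit_ball_def)
  \<comment> \<open>Up to the factor \<open>t\<close>, the point w + v lies in the ball of radius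
    \<open>c\<close> about -x and v in the one about x. So \<open>Q w\<close> is the value of a
    homogenised convex program in which the two balls are tested at points that differ by
    \<open>w\<close>. The given bound concerns w = 0, and a linear functional below \<open>Q\<close>
    is the multiplier that decouples the two balls.\<close>
  define D where "D w t v \<longleftrightarrow> v \<in> carrier X \<and> vnorm X (w \<oplus> v \<oplus> complex_of_real t \<odot> x) \<le> c * t \<and>
      vnorm X (v \<oplus> complex_of_real (- t) \<odot> x) \<le> c * t" for w t v
  define S where "S w = {\<epsilon> * t - Re (f v) |t v. D w t v}" for w
  define Q where "Q w = Inf (S w)" for w
  have scale: "D (complex_of_real r \<odot> w) (r * t) (complex_of_real r \<odot> v)"
    if "D w t v" "0 \<le> r" "w \<in> carrier X" for r w t v
  proof -
    have "complex_of_real r \<odot> w \<oplus> complex_of_real r \<odot> v \<oplus> complex_of_real (r * t) \<odot> x =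
        complex_of_real r \<odot> (w \<oplus> v \<oplus> complex_of_real t \<odot> x)"
      "complex_of_real r \<odot> v \<oplus> complex_of_real (- (r * t)) \<odot> x =
        complex_of_real r \<odot> (v \<oplus> complex_of_real (- t) \<odot> x)"
      using that xc by (simp_all add: smult_add D_def)
    then show ?thesis
      using that xc mult_left_mono[of _ "c * t" r] by (simp add: D_def vnorm_smult mult.left_commute)
  qed
  have add: "D (w \<oplus> w') (t + t') (v \<oplus> v')"
    if "D w t v" "D w' t' v'" "w \<in> carrier X" "w' \<in> carrier X" for w w' t t' v v'
  proof -
    have "w \<oplus> w' \<oplus> (v \<oplus> v') \<oplus> complex_of_real (t + t') \<odot> x =
        (w \<oplus> v \<oplus> complex_of_real t \<odot> x) \<oplus> (w' \<oplus> v' \<oplus> complex_of_real t' \<odot> x)"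
      "v \<oplus> v' \<oplus> complex_of_real (- (t + t')) \<odot> x =
        (v \<oplus> complex_of_real (- t) \<odot> x) \<oplus> (v' \<oplus> complex_of_real (- t') \<odot> x)"
      using that xc by (simp_all add: D_def add_smult a_ac)
        (simp_all add: add_smult[of _ "- complex_of_real t" "- complex_of_real t'", simplified] a_ac)
    then show ?thesis
      using that xc order_trans[OF vnorm_triangle add_mono] by (simp add: D_def distrib_left)
  qed
  have D_nonneg: "0 \<le> t" if "D w t v" "w \<in> carrier X" for w t v
  proof -
    have "0 \<le> c * t" using that xc vnorm_nonneg[of "v \<oplus> complex_of_real (- t) \<odot> x"]
      unfolding D_def by (simp del: of_real_minus)
    then show ?thesis using c by (simp add: zero_le_mult_iff)
  qed
  have diag: "Re (f v) \<le> \<epsilon> * t" if "D \<zero> t v" for t v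
  proof (cases "t = 0")
    case True
    have "vnorm X v = 0" using that True xc vnorm_nonneg[of v] by (auto simp: D_def)
    then show ?thesis using that True vnorm_eq_zero[of v] dual_linear(3)[OF f] by (simp add: D_def)
  next
    case False
    then have t: "t > 0" using D_nonneg[OF that] by simp
    have "D \<zero> 1 (complex_of_real (1 / t) \<odot> v)" using scale[OF that, of "1 / t"] t by simp
    moreover define u where "u = complex_of_real (1 / t) \<odot> v"
    ultimately have u: "D \<zero> 1 u" by simp
    have uc: "u \<in> carrier X" using u by (simp add: D_def)
    have "(-1) \<odot> (u \<oplus> (-1) \<odot> x) = x \<oplus> (-1) \<odot> u"
      using uc xc by (simp add: smult_add a_comm)
    then have "vnorm X (u \<oplus> (-1) \<odot> x) = vnorm X (x \<oplus> (-1) \<odot> u)"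
      using vnorm_smult[of "u \<oplus> (-1) \<odot> x" "-1"] uc xc by simp
    then have "Re (f u) \<le> \<epsilon>"
      using u uc xc by (intro bound) (auto simp: D_def a_comm)
    then show ?thesis
      using t that by (simp add: u_def D_def dual_linear[OF f] divide_le_eq)
  qed
  \<comment> \<open>Since c > 1, a large enough multiple of the ball about -x contains
    \<open>w\<close> together with 0. This makes \<open>Q\<close> finite from above and later bounds
    \<open>g\<close> by a multiple of the norm.\<close>
  have ex: "D w (vnorm X w / (c - 1)) \<zero>" if w: "w \<in> carrier X" for w
  proof -
    define t where "t = vnorm X w / (c - 1)"
    have "t * (c - 1) = vnorm X w" using c by (simp add: t_def)
    then have t: "t \<ge> 0" "vnorm X w = c * t - t"
      using c vnorm_nonneg[OF w] by (simp add: t_def, simp add: right_diff_distrib mult.commute)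
    have "t * vnorm X x \<le> t * 1" using t x1 by (intro mult_left_mono) auto
    moreover have "t \<le> c * t" using c t mult_right_mono[of 1 c t] by simp
    ultimately have "D w t \<zero>"
      using vnorm_triangle[of w "complex_of_real t \<odot> x"] w xc t
      by (simp add: D_def vnorm_smult)
    then show ?thesis by (simp add: t_def)
  qed
  \<comment> \<open>Feasible pairs for \<open>w\<close> and for its negative add up to one for 0,
    where \<open>diag\<close> makes the objective nonnegative; hence \<open>Q\<close> is bounded
    below.\<close>
  have low: "- r \<le> s" if "s \<in> S w" "r \<in> S ((-1) \<odot> w)" "w \<in> carrier X" for r s w
    using that diag[OF add[of w _ _ "(-1) \<odot> w", simplified]]
    by (fastforce simp: S_def D_def dual_linear[OF f] algebra_simps)
  have ne: "S w \<noteq> {}" if "w \<in> carrier X" for w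
    using ex[OF that] by (auto simp: S_def)
  have bdd: "bdd_below (S w)" if w: "w \<in> carrier X" for w
  proof -
    obtain r where "r \<in> S ((-1) \<odot> w)" using ne[of "(-1) \<odot> w"] w by auto
    then show ?thesis using low[OF _ _ w] by (intro bdd_belowI[of _ "- r"]) auto
  qed
  have Q_le: "Q w \<le> \<epsilon> * t - Re (f v)" if "D w t v" "w \<in> carrier X" for w t v
    unfolding Q_def using that bdd by (intro cInf_lower) (auto simp: S_def)
  have Q_ge: "m \<le> Q w" if "\<And>t v. D w t v \<Longrightarrow> m \<le> \<epsilon> * t - Re (f v)" "w \<in> carrier X" for m w
    unfolding Q_def using that ne by (intro cInf_greatest) (auto simp: S_def)
  have "sublinear Q"
    unfolding sublinear_def
  proof (intro conjI ballI allI impI)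
    fix w w' assume w: "w \<in> carrier X" and w': "w' \<in> carrier X"
    have *: "Q (w \<oplus> w') \<le> (\<epsilon> * t - Re (f v)) + (\<epsilon> * t' - Re (f v'))"
      if "D w t v" "D w' t' v'" for t v t' v'
      using Q_le[OF add[OF that w w']] that w w'
      by (simp add: D_def dual_linear[OF f] algebra_simps)
    have "Q (w \<oplus> w') - (\<epsilon> * t' - Re (f v')) \<le> Q w" if "D w' t' v'" for t' v'
      using *[OF _ that] by (intro Q_ge w) (simp add: algebra_simps)
    then have "Q (w \<oplus> w') - Q w \<le> Q w'"
      by (intro Q_ge w') (simp add: algebra_simps)
    then show "Q (w \<oplus> w') \<le> Q w + Q w'" by simp
  next
    fix r :: real and w assume r: "r > 0" and w: "w \<in> carrier X"
    have le: "Q (complex_of_real r \<odot> w) \<le> r * Q w" if r: "r > 0" and w: "w \<in> carrier X" for r w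
    proof -
      have "Q (complex_of_real r \<odot> w) / r \<le> Q w"
      proof (rule Q_ge[OF _ w])
        fix t v assume D: "D w t v"
        have "Q (complex_of_real r \<odot> w) \<le> (\<epsilon> * t - Re (f v)) * r"
          using Q_le[OF scale[OF D _ w, of r]] D r w
          by (simp add: D_def dual_linear[OF f] algebra_simps)
        then show "Q (complex_of_real r \<odot> w) / r \<le> \<epsilon> * t - Re (f v)"
          using r by (simp only: pos_divide_le_eq)
      qed
      then show ?thesis using r by (simp add: divide_le_eq mult.commute)
    qed
    have "Q w \<le> (1 / r) * Q (complex_of_real r \<odot> w)"
      using le[of "1 / r" "complex_of_real r \<odot> w"] r w by simp
    then show "Q (complex_of_real r \<odot> w) = r * Q w"
      using le[OF r w] r by (simp add: field_simps)
  qed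
  then obtain g where g: "real_linear g" and gQ: "\<And>u. u \<in> carrier X \<Longrightarrow> g u \<le> Q u"
    using hahn_banach by blast
  have gadd: "\<And>u v. u \<in> carrier X \<Longrightarrow> v \<in> carrier X \<Longrightarrow> g (u \<oplus> v) = g u + g v"
    and gsm: "\<And>r u. u \<in> carrier X \<Longrightarrow> g (complex_of_real r \<odot> u) = r * g u"
    using g by (auto simp: real_linear_def)
  have "g u \<le> (\<epsilon> / (c - 1)) * vnorm X u" if u: "u \<in> carrier X" for u
    using order_trans[OF gQ[OF u] Q_le[OF ex[OF u] u]] dual_linear(3)[OF f] by simp
  then have G: "complexify g \<in> carrier (dual X)" by (rule complexify_in_dual[OF g])
  interpret D: complex_normed_space "dual X" by (rule complex_normed_space_dual)
  define h where "h = f \<oplus>\<^bsub>dual X\<^esub> (-1) \<odot>\<^bsub>dual X\<^esub> complexify g"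
  have H: "h \<in> carrier (dual X)" using f G by (simp add: h_def)
  have hv: "h v = f v - complexify g v" if "v \<in> carrier X" for v
    using that by (simp add: h_def dual_def)
  have sum: "f = complexify g \<oplus>\<^bsub>dual X\<^esub> h"
    using f G by (simp add: h_def D.a_ac)
  \<comment> \<open>The value of \<open>Q\<close> at w = u - v with t = 1. The points
    \<open>u\<close> and \<open>v\<close> now range over the two balls independently, with
    \<open>g\<close> acting on one and \<open>h = f - g\<close> on the other.\<close>
  have key: "g u + Re (h v) \<le> \<epsilon>"
    if u: "u \<in> carrier X" "vnorm X (u \<oplus> x) \<le> c" and v: "v \<in> carrier X" "vnorm X (v \<oplus> (-1) \<odot> x) \<le> c"
    for u v
  proof -
    have eq: "u \<oplus> (-1) \<odot> v \<oplus> v = u" using u v by (simp add: a_assoc a_comm[of "(-1) \<odot> v" v])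
    then have "D (u \<oplus> (-1) \<odot> v) 1 v" using u v xc by (simp add: D_def)
    then have "g (u \<oplus> (-1) \<odot> v) \<le> \<epsilon> - Re (f v)"
      using gQ[of "u \<oplus> (-1) \<odot> v"] Q_le[of "u \<oplus> (-1) \<odot> v" 1 v] u v by simp
    moreover have "g (u \<oplus> (-1) \<odot> v) = g u - g v"
      using gadd[of "u \<oplus> (-1) \<odot> v" v] eq u v by simp
    ultimately show ?thesis using v by (simp add: hv)
  qed
  have "c * Re (complexify g u) - g x + (c * Re (h v) + Re (h x)) \<le> \<epsilon>"
    if u: "u \<in> unit_ball X" and v: "v \<in> unit_ball X" for u v
  proof -
    have uv: "u \<in> carrier X" "v \<in> carrier X" and n: "c * vnorm X u \<le> c * 1" "c * vnorm X v \<le> c * 1"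
      using u v c by (auto simp: unit_ball_def intro!: mult_left_mono)
    \<comment> \<open>As \<open>u\<close> and \<open>v\<close> run through the unit ball, these run
      through the balls of radius \<open>c\<close> about -x and x; the suprema then produce the two
      dual norms.\<close>
    define u' v' where "u' = complex_of_real c \<odot> u \<oplus> (-1) \<odot> x" and "v' = complex_of_real c \<odot> v \<oplus> x"
    have "u' \<oplus> x = complex_of_real c \<odot> u" "v' \<oplus> (-1) \<odot> x = complex_of_real c \<odot> v"
      using uv xc by (simp_all add: u'_def v'_def a_assoc a_comm[of "(-1) \<odot> x" x])
    then have "g u' + Re (h v') \<le> \<epsilon>"
      using uv xc n c by (intro key) (auto simp: u'_def v'_def vnorm_smult)
    moreover have "g u' = c * g u - g x"
      using gadd[of "complex_of_real c \<odot> u" "(-1) \<odot> x"] gsm[of u c] gsm[of x "-1"] uv xc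
      by (simp add: u'_def)
    moreover have "Re (h v') = c * Re (h v) + Re (h x)"
      using uv xc by (simp add: v'_def dual_linear[OF H])
    ultimately show ?thesis using uv by simp
  qed
  note key2 = this
  have rot: "\<exists>w\<in>unit_ball X. cmod (k u) = Re (k w)" if "k \<in> carrier (dual X)" "u \<in> unit_ball X" for k u
  proof -
    obtain z where z: "cmod z = 1" "z * k u = complex_of_real (cmod (k u))"
      using rotate_to_real .
    then show ?thesis using that
      by (intro bexI[of _ "z \<odot> u"]) (auto simp: dual_linear unit_ball_def vnorm_smult)
  qed
  have key3: "c * cmod (complexify g u) - g x + (c * cmod (h v) + Re (h x)) \<le> \<epsilon>"
    if u: "u \<in> unit_ball X" and v: "v \<in> unit_ball X" for u v
    using rot[OF G u] rot[OF H v] key2 by metis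
  have "vnorm (dual X) (complexify g) \<le> (\<epsilon> + g x - (c * cmod (h v) + Re (h x))) / c"
    if v: "v \<in> unit_ball X" for v
    using key3[OF _ v] c by (intro vnorm_dual_le) (simp add: le_divide_eq mult.commute algebra_simps)
  then have "vnorm (dual X) h \<le> (\<epsilon> + g x - (c * vnorm (dual X) (complexify g) + Re (h x))) / c"
    using c by (intro vnorm_dual_le) (simp add: le_divide_eq mult.commute algebra_simps)
  then have "c * vnorm (dual X) (complexify g) - Re (complexify g x) +
      (c * vnorm (dual X) h + Re (h x)) \<le> \<epsilon>"
    using c xc by (simp add: le_divide_eq mult.commute algebra_simps)
  then show ?thesis using that[OF G H sum] by blast
qed

text \<open>A functional \<open>f\<close> of norm at most 1 has real part at most \<epsilon> on the
  intersection of the two balls, by strong extremeness of \<open>x\<close>. After splitting f = g +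
  h, the bound on x + F controls Re (F g) and the bound on x - F controls Re (F h). Their sum is the
  quantity that \<open>split_functional\<close> bounds by \<epsilon>, so the same \<delta> serves in
  the bidual.\<close>

theorem strongly_extreme_bidual:
  assumes x: "strongly_extreme_point X x"
  shows "strongly_extreme_point (bidual X) (canonical_embedding X x)"
proof -
  interpret D: complex_normed_space "dual X" by (rule complex_normed_space_dual)
  interpret B: complex_normed_space "bidual X" by (rule D.complex_normed_space_dual)
  have xb: "x \<in> unit_ball X" using x by (simp add: strongly_extreme_point_def)
  then have xc: "x \<in> carrier X" by (simp add: unit_ball_def)
  let ?x = "canonical_embedding X x"
  note cx = canonical_embedding_in_bidual[OF xc]
  have "\<exists>\<delta>>0. \<forall>F\<in>carrier (bidual X). vnorm (bidual X) (?x \<oplus>\<^bsub>bidual X\<^esub> F) \<le> 1 + \<delta> \<and>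
        vnorm (bidual X) (?x \<oplus>\<^bsub>bidual X\<^esub> (-1) \<odot>\<^bsub>bidual X\<^esub> F) \<le> 1 + \<delta> \<longrightarrow> vnorm (bidual X) F \<le> \<epsilon>"
    if \<epsilon>: "\<epsilon> > 0" for \<epsilon> :: real
  proof -
    obtain \<delta> where \<delta>: "\<delta> > 0" and small: "\<And>y. y \<in> carrier X \<Longrightarrow> vnorm X (x \<oplus> y) \<le> 1 + \<delta> \<Longrightarrow>
        vnorm X (x \<oplus> (-1) \<odot> y) \<le> 1 + \<delta> \<Longrightarrow> vnorm X y \<le> \<epsilon>"
      using x \<epsilon> unfolding strongly_extreme_point_def by metis
    have "vnorm (bidual X) F \<le> \<epsilon>" if F: "F \<in> carrier (bidual X)"
      and p: "vnorm (bidual X) (?x \<oplus>\<^bsub>bidual X\<^esub> F) \<le> 1 + \<delta>"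
      and m: "vnorm (bidual X) (?x \<oplus>\<^bsub>bidual X\<^esub> (-1) \<odot>\<^bsub>bidual X\<^esub> F) \<le> 1 + \<delta>" for F
    proof (rule D.vnorm_dual_le)
      have le: "Re (F f) \<le> \<epsilon>" if f: "f \<in> unit_ball (dual X)" for f
      proof -
        have fc: "f \<in> carrier (dual X)" using f by (simp add: unit_ball_def)
        have "Re (f y) \<le> \<epsilon>"
          if "y \<in> carrier X" "vnorm X (x \<oplus> y) \<le> 1 + \<delta>" "vnorm X (x \<oplus> (-1) \<odot> y) \<le> 1 + \<delta>" for y
        proof -
          have "cmod (f y) \<le> vnorm (dual X) f * vnorm X y" by (rule vnorm_dual[OF fc that(1)])
          also have "\<dots> \<le> 1 * vnorm X y"
            using f vnorm_nonneg[OF that(1)] by (intro mult_right_mono) (auto simp: unit_ball_def)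
          finally show ?thesis using small[OF that] complex_Re_le_cmod[of "f y"] by simp
        qed
        then obtain g h where g: "g \<in> carrier (dual X)" and h: "h \<in> carrier (dual X)"
          and fgh: "f = g \<oplus>\<^bsub>dual X\<^esub> h"
          and gh: "(1 + \<delta>) * vnorm (dual X) g - Re (g x) + ((1 + \<delta>) * vnorm (dual X) h + Re (h x)) \<le> \<epsilon>"
          using split_functional[OF xb fc, of "1 + \<delta>" \<epsilon>] \<delta> \<epsilon> by auto
        have "Re (g x + F g) \<le> (1 + \<delta>) * vnorm (dual X) g"
        proof -
          have "cmod ((?x \<oplus>\<^bsub>bidual X\<^esub> F) g) \<le> vnorm (bidual X) (?x \<oplus>\<^bsub>bidual X\<^esub> F) * vnorm (dual X) g"
            using cx F g by (intro D.vnorm_dual) auto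
          also have "\<dots> \<le> (1 + \<delta>) * vnorm (dual X) g"
            by (intro mult_right_mono p D.vnorm_nonneg g)
          also have "(?x \<oplus>\<^bsub>bidual X\<^esub> F) g = g x + F g"
            using g by (simp add: dual_def[of "dual X"] canonical_embedding_def)
          finally show ?thesis using complex_Re_le_cmod order_trans by blast
        qed
        moreover have "Re (- (h x - F h)) \<le> (1 + \<delta>) * vnorm (dual X) h"
        proof -
          have "cmod ((?x \<oplus>\<^bsub>bidual X\<^esub> (-1) \<odot>\<^bsub>bidual X\<^esub> F) h) \<le>
              vnorm (bidual X) (?x \<oplus>\<^bsub>bidual X\<^esub> (-1) \<odot>\<^bsub>bidual X\<^esub> F) * vnorm (dual X) h"
            using cx F h by (intro D.vnorm_dual) auto
          also have "\<dots> \<le> (1 + \<delta>) * vnorm (dual X) h"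
            by (intro mult_right_mono m D.vnorm_nonneg h)
          also have "(?x \<oplus>\<^bsub>bidual X\<^esub> (-1) \<odot>\<^bsub>bidual X\<^esub> F) h = h x - F h"
            using h by (simp add: dual_def[of "dual X"] canonical_embedding_def)
          finally show ?thesis using complex_Re_le_cmod order_trans norm_minus_cancel by metis
        qed
        moreover have "F f = F g + F h"
          using D.dual_linear(1)[OF F g h] fgh by simp
        ultimately show ?thesis using gh by simp
      qed
      fix f assume f: "f \<in> unit_ball (dual X)"
      then have fc: "f \<in> carrier (dual X)" by (simp add: unit_ball_def)
      obtain z where z: "cmod z = 1" "z * F f = complex_of_real (cmod (F f))"
        using rotate_to_real .
      then have "cmod (F f) = Re (F (z \<odot>\<^bsub>dual X\<^esub> f))"
        using D.dual_linear(2)[OF F fc, of z] by simp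
      also have "\<dots> \<le> \<epsilon>"
        using f z by (intro le) (simp add: unit_ball_def D.vnorm_smult)
      finally show "cmod (F f) \<le> \<epsilon>" .
    qed
    then show ?thesis using \<delta> by blast
  qed
  then show ?thesis
    using cx xb by (auto simp: strongly_extreme_point_def unit_ball_def)
qed

end

section \<open>Isometric copies and dual towers\<close>

lemma isometric_isomorphismD:
  assumes "isometric_isomorphism X Y \<phi>"
  shows "carrier Y = \<phi> ` carrier X" "inj_on \<phi> (carrier X)" "\<zero>\<^bsub>Y\<^esub> = \<phi> \<zero>\<^bsub>X\<^esub>"
    and "\<And>x y. x \<in> carrier X \<Longrightarrow> y \<in> carrier X \<Longrightarrow> \<phi> x \<oplus>\<^bsub>Y\<^esub> \<phi> y = \<phi> (x \<oplus>\<^bsub>X\<^esub> y)"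
    and "\<And>c x. x \<in> carrier X \<Longrightarrow> c \<odot>\<^bsub>Y\<^esub> \<phi> x = \<phi> (c \<odot>\<^bsub>X\<^esub> x)"
    and "\<And>x. x \<in> carrier X \<Longrightarrow> vnorm Y (\<phi> x) = vnorm X x"
  using assms by (auto simp: isometric_isomorphism_def bij_betw_def)

lemma complex_normed_space_iso:
  assumes iso: "isometric_isomorphism X Y \<phi>" and X: "complex_normed_space X"
  shows "complex_normed_space Y"
proof -
  interpret complex_normed_space X by (rule X)
  note I = isometric_isomorphismD[OF iso]
  have ab: "abelian_group Y"
  proof (rule abelian_groupI)
    fix y assume "y \<in> carrier Y"
    then obtain x where x: "x \<in> carrier X" "y = \<phi> x" by (auto simp: I(1))
    show "\<exists>z\<in>carrier Y. z \<oplus>\<^bsub>Y\<^esub> y = \<zero>\<^bsub>Y\<^esub>"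
      by (rule bexI[of _ "\<phi> ((-1) \<odot>\<^bsub>X\<^esub> x)"])
        (use x in \<open>auto simp: I a_comm[of "(-1) \<odot>\<^bsub>X\<^esub> x" x]\<close>)
  qed (auto simp: I a_ac)
  have md: "module complex_ring Y"
  proof (rule moduleI)
    show "cring complex_ring" by (rule R.is_cring)
  qed (use ab in \<open>auto simp: complex_ring_def I add_smult smult_add\<close>)
  interpret Y: module complex_ring Y by (rule md)
  show ?thesis
  proof
    fix y assume "y \<in> carrier Y"
    then obtain x where x: "x \<in> carrier X" "y = \<phi> x" by (auto simp: I(1))
    show "0 \<le> vnorm Y y" using x by (simp add: I vnorm_nonneg)
    show "vnorm Y y = 0 \<longleftrightarrow> y = \<zero>\<^bsub>Y\<^esub>"
      using x inj_on_eq_iff[OF I(2)] by (simp add: I vnorm_eq_zero)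
    show "vnorm Y (c \<odot>\<^bsub>Y\<^esub> y) = cmod c * vnorm Y y" for c
      using x by (simp add: I vnorm_smult)
    fix z assume "z \<in> carrier Y"
    then obtain w where w: "w \<in> carrier X" "z = \<phi> w" by (auto simp: I(1))
    show "vnorm Y (y \<oplus>\<^bsub>Y\<^esub> z) \<le> vnorm Y y + vnorm Y z"
      using x w by (simp add: I vnorm_triangle)
  qed
qed

lemma strongly_extreme_point_iso:
  assumes iso: "isometric_isomorphism X Y \<phi>" and X: "complex_normed_space X"
    and x: "strongly_extreme_point X x"
  shows "strongly_extreme_point Y (\<phi> x)"
proof -
  interpret complex_normed_space X by (rule X)
  note I = isometric_isomorphismD[OF iso]
  have "x \<in> carrier X" using x by (simp add: strongly_extreme_point_def unit_ball_def)
  then show ?thesis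
    using x unfolding strongly_extreme_point_def unit_ball_def by (auto simp: I)
qed

lemma isometric_isomorphism_inv:
  assumes iso: "isometric_isomorphism X Y \<phi>" and X: "complex_normed_space X"
  shows "isometric_isomorphism Y X (inv_into (carrier X) \<phi>)"
proof -
  interpret complex_normed_space X by (rule X)
  note I = isometric_isomorphismD[OF iso]
  have "bij_betw (inv_into (carrier X) \<phi>) (carrier Y) (carrier X)"
    using iso by (intro bij_betw_inv_into) (simp add: isometric_isomorphism_def)
  then show ?thesis
    unfolding isometric_isomorphism_def using I(2) by (auto simp: I)
qed

text \<open>Transposing the inverse of \<open>T k\<close> identifies the bidual of
  \<open>D k\<close> with the dual of \<open>D (Suc k)\<close>, and \<open>T (Suc k)\<close> carries
  that to the next copy. The composite does not depend on \<open>y\<close>, so the tower embedding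
  is the canonical one up to a fixed isometric isomorphism.\<close>

lemma tower_embedding_canonical:
  assumes X: "complex_normed_space (D k)"
    and T: "isometric_isomorphism (dual (D k)) (D (Suc k)) (T k)"
    and T': "isometric_isomorphism (dual (D (Suc k))) (D (Suc (Suc k))) (T (Suc k))"
  obtains \<psi> where "isometric_isomorphism (bidual (D k)) (D (Suc (Suc k))) \<psi>"
    "\<And>y. tower_embedding D T k y = \<psi> (canonical_embedding (D k) y)"
proof -
  interpret complex_normed_space "D k" by (rule X)
  let ?inv = "inv_into (carrier (dual (D k))) (T k)"
  let ?\<psi> = "\<lambda>F. \<lambda>z\<in>carrier (D (Suc k)). F (?inv z)"
  have inv: "isometric_isomorphism (D (Suc k)) (dual (D k)) ?inv"
    by (rule isometric_isomorphism_inv[OF T complex_normed_space_dual])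
  have "closed_ops (D (Suc k))"
    by (intro closed_ops_normed complex_normed_space_iso[OF T complex_normed_space_dual])
  then have "isometric_isomorphism (bidual (D k)) (dual (D (Suc k))) ?\<psi>"
    by (rule iso_dual[OF inv])
  then have "isometric_isomorphism (bidual (D k)) (D (Suc (Suc k))) (T (Suc k) \<circ> ?\<psi>)"
    by (rule iso_comp[OF _ T'])
  moreover have "tower_embedding D T k y = (T (Suc k) \<circ> ?\<psi>) (canonical_embedding (D k) y)" for y
  proof -
    have "?inv z \<in> carrier (dual (D k))" if "z \<in> carrier (D (Suc k))" for z
      using inv that by (auto simp: isometric_isomorphism_def bij_betw_def)
    then show ?thesis
      by (simp add: tower_embedding_def canonical_embedding_def cong: restrict_cong)
  qed
  ultimately show ?thesis by (rule that)
qed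

text \<open>The induction runs on strong extremeness, which each bidual inherits; weak-star
  extremeness at one level would say nothing about the level after the next bidual. The normed space
  property is carried along because the copies \<open>D k\<close> are not assumed to have
  it.\<close>

lemma strongly_extreme_tower:
  assumes X: "complex_normed_space X" and x: "strongly_extreme_point X x"
    and tower: "dual_tower X (2 * n) D \<iota> T"
  shows "complex_normed_space (D (2 * n)) \<and>
    strongly_extreme_point (D (2 * n)) (even_dual_embedding D \<iota> T n x)"
  using tower
proof (induction n)
  case 0
  then have "isometric_isomorphism X (D 0) \<iota>" by (simp add: dual_tower_def)
  from complex_normed_space_iso[OF this X] strongly_extreme_point_iso[OF this X x]
  show ?case by simp
next
  case (Suc n)
  then have "dual_tower X (2 * n) D \<iota> T" by (simp add: dual_tower_def)
  then have N: "complex_normed_space (D (2 * n))"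
    and S: "strongly_extreme_point (D (2 * n)) (even_dual_embedding D \<iota> T n x)"
    using Suc.IH by auto
  have T: "isometric_isomorphism (dual (D k)) (D (Suc k)) (T k)" if "k < 2 * Suc n" for k
    using Suc.prems that by (simp add: dual_tower_def)
  obtain \<psi> where \<psi>: "isometric_isomorphism (bidual (D (2 * n))) (D (Suc (Suc (2 * n)))) \<psi>"
    and te: "\<And>y. tower_embedding D T (2 * n) y = \<psi> (canonical_embedding (D (2 * n)) y)"
    using tower_embedding_canonical[OF N T T] by auto
  interpret N: complex_normed_space "D (2 * n)" by (rule N)
  interpret N': complex_normed_space "dual (D (2 * n))" by (rule N.complex_normed_space_dual)
  note B = N'.complex_normed_space_dual
  show ?case
    using complex_normed_space_iso[OF \<psi> B]
      strongly_extreme_point_iso[OF \<psi> B N.strongly_extreme_bidual[OF S]] by (simp add: te)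
qed

lemma strongly_extreme_imp_weak_star_extreme:
  assumes X: "complex_normed_space X" and x: "strongly_extreme_point X x"
  shows "weak_star_extreme_point X x"
proof -
  interpret complex_normed_space X by (rule X)
  interpret D: complex_normed_space "dual X" by (rule complex_normed_space_dual)
  interpret B: complex_normed_space "bidual X" by (rule D.complex_normed_space_dual)
  show ?thesis
    unfolding weak_star_extreme_point_def
    using strongly_extreme_imp_linear_extreme[OF x]
      B.strongly_extreme_imp_linear_extreme[OF strongly_extreme_bidual[OF x]] by simp
qed

section \<open>Norm estimates in C*-algebras\<close>

context complex_normed_space
begin

text \<open>
  Bounded functionals separate points, so an identity in \<open>X\<close> may be checked after pairing with
  all of them, which leaves an identity of complex numbers.
\<close>

definition pairing :: "'a \<Rightarrow> ('a \<Rightarrow> complex) \<Rightarrow> complex" where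
  "pairing u f = (if f \<in> carrier (dual X) then f u else 0)"

lemma pairing_add: "u \<in> carrier X \<Longrightarrow> v \<in> carrier X \<Longrightarrow> pairing (u \<oplus> v) f = pairing u f + pairing v f"
  by (simp add: pairing_def dual_linear)

lemma pairing_smult: "u \<in> carrier X \<Longrightarrow> pairing (c \<odot> u) f = c * pairing u f"
  by (simp add: pairing_def dual_linear)

lemma pairing_zero: "pairing \<zero> f = 0"
  by (simp add: pairing_def dual_linear)

lemma pairing_eqI:
  assumes "u \<in> carrier X" "v \<in> carrier X" "\<And>f. pairing u f = pairing v f"
  shows "u = v"
proof (rule ccontr)
  assume "u \<noteq> v"
  have "u \<oplus> (-1) \<odot> v \<noteq> \<zero>"
  proof
    assume z: "u \<oplus> (-1) \<odot> v = \<zero>"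
    have "u \<oplus> (-1) \<odot> v \<oplus> v = u" using assms(1,2) by (simp add: a_assoc a_comm[of "(-1) \<odot> v" v])
    then show False using z assms(1,2) \<open>u \<noteq> v\<close> by simp
  qed
  then obtain f where "f \<in> carrier (dual X)" "f (u \<oplus> (-1) \<odot> v) \<noteq> 0"
    using separate_from_zero[of "u \<oplus> (-1) \<odot> v"] assms(1,2) by auto
  then show False
    using assms(3)[of f] assms(1,2) by (simp add: pairing_def dual_linear)
qed

end

text \<open>Under roots of growing order the factor 2 tends to 1. Only powers of two occur as
  exponents because they are the ones that repeated squaring reaches.\<close>

lemma le_of_power_le:
  fixes t M :: real
  assumes "0 \<le> t" "0 \<le> M" and le: "\<And>k. t ^ (2 ^ k) \<le> 2 * M ^ (2 ^ k)"
  shows "t \<le> M"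
proof (rule ccontr)
  assume "\<not> t \<le> M"
  then have "M < t" by simp
  have "M > 0"
  proof (rule ccontr)
    assume "\<not> M > 0"
    then show False using le[of 0] \<open>M < t\<close> assms by simp
  qed
  then have "t / M > 1" using \<open>M < t\<close> by simp
  then obtain n where n: "2 < (t / M) ^ n" using real_arch_pow by blast
  also have "(t / M) ^ n \<le> (t / M) ^ (2 ^ n)"
    using \<open>t / M > 1\<close> less_exp[of n] by (intro power_increasing) auto
  also have "\<dots> \<le> 2" using le[of n] \<open>M > 0\<close> by (simp add: power_divide divide_le_eq)
  finally show False by simp
qed

section \<open>Rewriting in the algebra, self-adjoint elements and approximate square roots\<close>

context unital_cstar_algebra
begin

lemmas adj_simps [simp] = adj_closed adj_adj adj_add adj_smult adj_mult

text \<open>Expands the pairing of a polynomial expression into a complex combination of pairings of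
  words bracketed to the right.\<close>

lemmas expand = minus_smult pairing_add pairing_smult pairing_zero l_distr r_distr
  smult_mult_left smult_mult_right m_assoc

text \<open>Inside a word bracketed to the right, the left side of a relation
  \<open>a \<otimes> b = w\<close> no longer appears as a subterm; this form of the relation still
  rewrites there.\<close>

lemma word_eq: "a \<otimes> b = w \<Longrightarrow> a \<in> carrier A \<Longrightarrow> b \<in> carrier A \<Longrightarrow> z \<in> carrier A \<Longrightarrow> a \<otimes> (b \<otimes> z) = w \<otimes> z"
  by (simp add: m_assoc[symmetric])

lemma adj_one [simp]: "adj A \<one> = \<one>"
proof -
  have "adj A (adj A \<one> \<otimes> \<one>) = \<one> \<otimes> adj A \<one>" by (simp del: r_one l_one) (simp add: l_one)
  then show ?thesis by simp
qed

lemma adj_zero [simp]: "adj A \<zero> = \<zero>"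
  using adj_smult[of \<zero> 0] by simp

lemma vnorm_adj [simp]:
  assumes x: "x \<in> carrier A" shows "vnorm A (adj A x) = vnorm A x"
proof -
  have le: "vnorm A x \<le> vnorm A (adj A x)" if x: "x \<in> carrier A" for x
  proof (cases "vnorm A x = 0")
    case False
    then have "vnorm A x > 0" using vnorm_nonneg[OF x] by simp
    then show ?thesis
      using cstar_identity[OF x] vnorm_mult[of "adj A x" x] x
      by (simp add: power2_eq_square)
  qed (use x vnorm_nonneg[of "adj A x"] in simp)
  show ?thesis using le[OF x] le[of "adj A x"] x by simp
qed

text \<open>The C*-identity says that the norm of the unit is its own square, so it is 0 or 1; the
  value 0 belongs to the zero algebra.\<close>

lemma vnorm_one: "vnorm A \<one> \<le> 1"
proof -
  have "vnorm A \<one> * vnorm A \<one> = vnorm A \<one> * 1"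
    using cstar_identity[of \<one>] by (simp add: power2_eq_square)
  then show ?thesis unfolding mult_cancel_left by auto
qed

definition sa :: "'a \<Rightarrow> bool" where
  "sa a \<longleftrightarrow> a \<in> carrier A \<and> adj A a = a"

lemma sa_closed [simp]: "sa a \<Longrightarrow> a \<in> carrier A"
  by (simp add: sa_def)

lemma sa_adj [simp]: "sa a \<Longrightarrow> adj A a = a"
  by (simp add: sa_def)

lemma sa_intros [simp]:
  "sa \<one>" "sa \<zero>" "sa a \<Longrightarrow> sa b \<Longrightarrow> sa (a \<oplus> b)" "sa a \<Longrightarrow> sa (a \<otimes> a)"
  "sa a \<Longrightarrow> cnj c = c \<Longrightarrow> sa (c \<odot> a)" "x \<in> carrier A \<Longrightarrow> sa (adj A x \<otimes> x)"
  "x \<in> carrier A \<Longrightarrow> sa (x \<otimes> adj A x)"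
  unfolding sa_def by auto

lemma sa_mult: "sa a \<Longrightarrow> sa b \<Longrightarrow> a \<otimes> b = b \<otimes> a \<Longrightarrow> sa (a \<otimes> b)"
  unfolding sa_def by simp

lemma vnorm_square: "sa a \<Longrightarrow> vnorm A (a \<otimes> a) = (vnorm A a)\<^sup>2"
  using cstar_identity[of a] by simp

lemma vnorm_le_iff_adj_mult:
  assumes "x \<in> carrier A" "0 \<le> r"
  shows "vnorm A x \<le> r \<longleftrightarrow> vnorm A (adj A x \<otimes> x) \<le> r\<^sup>2"
  using assms vnorm_nonneg[of x] abs_le_square_iff[of "vnorm A x" r] by (simp add: cstar_identity)

text \<open>Orthogonality removes the cross terms in repeated squares, so a + b raised to the power
  2^k is the sum of the corresponding powers of \<open>a\<close> and \<open>b\<close>, of norm at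
  most twice M^(2^k). For self-adjoint elements squaring squares the norm, and taking roots removes
  the 2.\<close>

lemma vnorm_orthogonal_sum:
  assumes a: "sa a" and b: "sa b" and ab: "a \<otimes> b = \<zero>"
    and M: "vnorm A a \<le> M" "vnorm A b \<le> M"
  shows "vnorm A (a \<oplus> b) \<le> M"
proof (rule le_of_power_le)
  show "0 \<le> vnorm A (a \<oplus> b)" using a b by (simp add: vnorm_nonneg)
  show "0 \<le> M" using M a vnorm_nonneg[of a] by simp
  fix k
  show "vnorm A (a \<oplus> b) ^ (2 ^ k) \<le> 2 * M ^ (2 ^ k)"
    using a b ab M
  proof (induction k arbitrary: a b M)
    case 0
    then show ?case using vnorm_triangle[of a b] by simp
  next
    case (Suc k)
    have "b \<otimes> a = adj A (a \<otimes> b)" using Suc.prems(1,2) by simp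
    then have ba: "b \<otimes> a = \<zero>" using Suc.prems(3) by simp
    have sq: "(a \<oplus> b) \<otimes> (a \<oplus> b) = a \<otimes> a \<oplus> b \<otimes> b"
      using Suc.prems ba by (simp add: l_distr r_distr)
    have "a \<otimes> a \<otimes> (b \<otimes> b) = \<zero>"
      using Suc.prems word_eq[OF Suc.prems(3)] by (simp add: m_assoc)
    moreover have "vnorm A (a \<otimes> a) \<le> M\<^sup>2" "vnorm A (b \<otimes> b) \<le> M\<^sup>2"
      using Suc.prems vnorm_nonneg[of a] vnorm_nonneg[of b] by (auto simp: vnorm_square intro!: power_mono)
    ultimately have "vnorm A (a \<otimes> a \<oplus> b \<otimes> b) ^ (2 ^ k) \<le> 2 * (M\<^sup>2) ^ (2 ^ k)"
      using Suc.prems by (intro Suc.IH) simp_all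
    moreover have "vnorm A (a \<otimes> a \<oplus> b \<otimes> b) = (vnorm A (a \<oplus> b))\<^sup>2"
      using Suc.prems vnorm_square[of "a \<oplus> b"] sq by simp
    ultimately show ?case by (simp add: power_mult[symmetric])
  qed
qed

text \<open>
  With \<open>y' = (g + y\<^sup>2) / 2\<close> and \<open>c = 1 - y\<close> one has \<open>c\<^sup>2 - (1 - g) = 2 (y' - y)\<close>. The increments are
  dominated by those of the scalar iteration for \<open>g = 1\<close>, which converges.
\<close>

lemma approx_sqrt:
  assumes g: "sa g" and g1: "vnorm A g \<le> 1" and e: "e > 0"
  obtains c where "sa c" "\<forall>b\<in>carrier A. b \<otimes> g = g \<otimes> b \<longrightarrow> b \<otimes> c = c \<otimes> b"
    "vnorm A (c \<otimes> c \<ominus> (\<one> \<ominus> g)) \<le> e"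
proof -
  define y where "y = rec_nat \<zero> (\<lambda>_ z. (1/2) \<odot> (g \<oplus> z \<otimes> z))"
  define \<eta> where "\<eta> = rec_nat (0 :: real) (\<lambda>_ t. (1 + t\<^sup>2) / 2)"
  have y0: "y 0 = \<zero>" and yS: "y (Suc n) = (1/2) \<odot> (g \<oplus> y n \<otimes> y n)" for n
    by (simp_all add: y_def)
  have \<eta>0: "\<eta> 0 = 0" and \<eta>S: "\<eta> (Suc n) = (1 + (\<eta> n)\<^sup>2) / 2" for n
    by (simp_all add: \<eta>_def)
  have sa: "sa (y n)" for n by (induction n) (use g in \<open>simp_all add: y0 yS\<close>)
  have comm: "b \<otimes> y n = y n \<otimes> b" if b: "b \<in> carrier A" "b \<otimes> g = g \<otimes> b" for b n
  proof (induction n)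
    case (Suc n)
    have "b \<otimes> (y n \<otimes> y n) = y n \<otimes> y n \<otimes> b"
      using b sa[of n] Suc by (simp add: m_assoc word_eq[OF Suc])
    then show ?case
      using b g sa[of n] by (simp add: yS smult_mult_left smult_mult_right l_distr r_distr)
  qed (use b in \<open>simp add: y0\<close>)
  have \<eta>_nonneg: "0 \<le> \<eta> n" for n by (induction n) (simp_all add: \<eta>0 \<eta>S)
  have yn: "vnorm A (y n) \<le> \<eta> n" for n
  proof (induction n)
    case (Suc n)
    have "vnorm A (g \<oplus> y n \<otimes> y n) \<le> 1 + (\<eta> n)\<^sup>2"
    proof -
      have "vnorm A (g \<oplus> y n \<otimes> y n) \<le> vnorm A g + vnorm A (y n \<otimes> y n)"
        using g sa[of n] by (intro vnorm_triangle) auto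
      moreover have "vnorm A (y n \<otimes> y n) \<le> (\<eta> n)\<^sup>2"
        using sa[of n] Suc vnorm_nonneg[of "y n"] by (simp add: vnorm_square power_mono)
      ultimately show ?thesis using g1 by simp
    qed
    then show ?case using g sa[of n] by (simp add: yS \<eta>S vnorm_smult norm_divide)
  qed (simp add: y0 \<eta>0)
  have inc: "vnorm A (y (Suc n) \<ominus> y n) \<le> \<eta> (Suc n) - \<eta> n" for n
  proof (induction n)
    case 0
    have "y (Suc 0) \<ominus> y 0 = (1/2) \<odot> g" using g by (simp add: y0 yS minus_smult)
    then show ?case using g g1 by (simp add: vnorm_smult \<eta>0 \<eta>S norm_divide)
  next
    case (Suc n)
    \<comment> \<open>The difference of two squares, factored in a form that needs no commutation of
      \<open>Y\<close> and \<open>Y'\<close>.\<close>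
    have "(1/2) \<odot> (g \<oplus> Y' \<otimes> Y') \<ominus> (1/2) \<odot> (g \<oplus> Y \<otimes> Y) =
        (1/2) \<odot> (Y' \<otimes> (Y' \<ominus> Y) \<oplus> (Y' \<ominus> Y) \<otimes> Y)"
      if "Y \<in> carrier A" "Y' \<in> carrier A" for Y Y'
      using g that by (intro pairing_eqI) (simp_all add: expand field_simps)
    from this[of "y n" "y (Suc n)"]
    have eq: "y (Suc (Suc n)) \<ominus> y (Suc n) =
      (1/2) \<odot> (y (Suc n) \<otimes> (y (Suc n) \<ominus> y n) \<oplus> (y (Suc n) \<ominus> y n) \<otimes> y n)"
      using sa by (simp only: yS[symmetric] sa_closed)
    define d where "d = y (Suc n) \<ominus> y n"
    have d: "d \<in> carrier A" "vnorm A d \<le> \<eta> (Suc n) - \<eta> n"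
      using Suc sa[of n] sa[of "Suc n"] by (simp_all add: d_def)
    have "vnorm A (y (Suc n) \<otimes> d \<oplus> d \<otimes> y n) \<le>
        vnorm A (y (Suc n)) * vnorm A d + vnorm A d * vnorm A (y n)"
      using vnorm_triangle[of "y (Suc n) \<otimes> d" "d \<otimes> y n"] vnorm_mult[of "y (Suc n)" d]
        vnorm_mult[of d "y n"] d sa[of n] sa[of "Suc n"] by simp
    also have "\<dots> \<le> \<eta> (Suc n) * (\<eta> (Suc n) - \<eta> n) + (\<eta> (Suc n) - \<eta> n) * \<eta> n"
      using d yn[of n] yn[of "Suc n"] \<eta>_nonneg[of n] \<eta>_nonneg[of "Suc n"]
        vnorm_nonneg[OF d(1)] vnorm_nonneg[OF sa_closed[OF sa[of n]]]
      by (intro add_mono mult_mono) linarith+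
    also have "\<dots> = 2 * (\<eta> (Suc (Suc n)) - \<eta> (Suc n))"
      by (simp add: \<eta>S[of "Suc n"] \<eta>S[of n] power2_eq_square field_simps)
    finally show ?case
      using d sa[of n] sa[of "Suc n"]
      unfolding eq d_def[symmetric] by (simp add: vnorm_smult norm_divide)
  qed
  \<comment> \<open>Increments all above e/2 would make \<open>\<eta>\<close> exceed its bound
    1.\<close>
  have "\<exists>n. 2 * (\<eta> (Suc n) - \<eta> n) \<le> e"
  proof (rule ccontr)
    assume *: "\<not> ?thesis"
    have "real n * (e / 2) \<le> \<eta> n" for n
    proof (induction n)
      case (Suc n)
      have "e / 2 < \<eta> (Suc n) - \<eta> n" using * by (simp add: not_le) (metis mult.commute)
      then show ?case using Suc by (simp add: algebra_simps)
    qed (simp add: \<eta>0)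
    moreover have "\<eta> n \<le> 1" for n
      by (induction n) (use \<eta>_nonneg in \<open>simp_all add: \<eta>0 \<eta>S power_le_one\<close>)
    moreover obtain n where "1 < real n * (e / 2)"
      using reals_Archimedean3[of "e / 2"] e by (meson half_gt_zero)
    ultimately show False by (meson leD order_trans)
  qed
  then obtain n where n: "2 * (\<eta> (Suc n) - \<eta> n) \<le> e" ..
  define c where "c = \<one> \<ominus> y n"
  show ?thesis
  proof (rule that)
    show "sa c" using sa[of n] by (simp add: c_def minus_smult)
    have "b \<otimes> c = c \<otimes> b" if "b \<in> carrier A" "b \<otimes> g = g \<otimes> b" for b
      using comm[OF that, of n] sa[of n] that
      by (simp add: c_def minus_smult l_distr r_distr smult_mult_left smult_mult_right)
    then show "\<forall>b\<in>carrier A. b \<otimes> g = g \<otimes> b \<longrightarrow> b \<otimes> c = c \<otimes> b" by blast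
    have "(\<one> \<ominus> Y) \<otimes> (\<one> \<ominus> Y) \<ominus> (\<one> \<ominus> g) = 2 \<odot> ((1/2) \<odot> (g \<oplus> Y \<otimes> Y) \<ominus> Y)"
      if "Y \<in> carrier A" for Y
      using g that by (intro pairing_eqI) (simp_all add: expand field_simps)
    from this[of "y n"] have "c \<otimes> c \<ominus> (\<one> \<ominus> g) = 2 \<odot> (y (Suc n) \<ominus> y n)"
      using sa[of n] by (simp add: c_def yS)
    then show "vnorm A (c \<otimes> c \<ominus> (\<one> \<ominus> g)) \<le> e"
      using n inc[of n] sa[of n] sa[of "Suc n"] by (simp add: vnorm_smult)
  qed
qed

text \<open>If \<open>b\<^sup>2 + d\<^sup>2\<close> is close to \<open>1\<close>, then \<open>b\<close> is the real part of the nearly isometric \<open>b + i d\<close>.\<close>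

lemma vnorm_le_one:
  assumes b: "sa b"
    and d: "\<And>e. e > 0 \<Longrightarrow> \<exists>d. sa d \<and> b \<otimes> d = d \<otimes> b \<and> vnorm A (b \<otimes> b \<oplus> d \<otimes> d \<ominus> \<one>) \<le> e"
  shows "vnorm A b \<le> 1"
proof -
  have "(vnorm A b)\<^sup>2 \<le> 1 + e" if e: "e > 0" for e
  proof -
    obtain d where sd: "sa d" and comm: "b \<otimes> d = d \<otimes> b"
      and le: "vnorm A (b \<otimes> b \<oplus> d \<otimes> d \<ominus> \<one>) \<le> e"
      using d[OF e] by blast
    define u where "u = b \<oplus> \<i> \<odot> d"
    have u: "u \<in> carrier A" using b sd by (simp add: u_def)
    \<comment> \<open>The cross terms are i (b d - d b) and vanish because \<open>b\<close> and
      \<open>d\<close> commute.\<close>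
    have "adj A u \<otimes> u = (b \<otimes> b \<oplus> d \<otimes> d \<ominus> \<one>) \<oplus> \<one>"
      using b sd comm by (intro pairing_eqI) (simp_all add: u_def expand field_simps)
    then have "(vnorm A u)\<^sup>2 \<le> e + 1"
      using cstar_identity[OF u] vnorm_triangle[of "b \<otimes> b \<oplus> d \<otimes> d \<ominus> \<one>" \<one>] le vnorm_one b sd
      by simp
    moreover have "b = (1/2) \<odot> (u \<oplus> adj A u)"
      using b sd by (intro pairing_eqI) (simp_all add: u_def expand)
    then have "vnorm A b \<le> vnorm A u"
      using vnorm_triangle[of u "adj A u"] u
      by (metis (no_types) adj_closed a_closed vnorm_smult vnorm_adj norm_divide norm_one norm_numeral
          mult.commute field_sum_of_halves mult_2 times_divide_eq_right divide_le_eq_numeral1(1) mult_1 mult_1_right)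
    then have "(vnorm A b)\<^sup>2 \<le> (vnorm A u)\<^sup>2"
      using b vnorm_nonneg[of b] by (intro power_mono) auto
    ultimately show ?thesis by simp
  qed
  then have "(vnorm A b)\<^sup>2 \<le> 1" by (rule field_le_epsilon)
  then show ?thesis using power2_le_imp_le[of "vnorm A b" 1] by simp
qed

text \<open>For s = 1 this is the double-angle formula: if c^2 is close to 1 - a^2, then 2 a c is
  the partner of 2 a^2 - 1 that \<open>vnorm_le_one\<close> asks for. The defect is 4 a^2 (c^2 - (1
  - a^2)), which explains the tolerance e/4.\<close>

lemma square_centred:
  assumes a: "sa a" and s: "vnorm A a \<le> s"
  shows "vnorm A (2 \<odot> (a \<otimes> a) \<ominus> complex_of_real (s\<^sup>2) \<odot> \<one>) \<le> s\<^sup>2"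
proof -
  have unit: "vnorm A (2 \<odot> (a \<otimes> a) \<ominus> \<one>) \<le> 1" if a: "sa a" and a1: "vnorm A a \<le> 1" for a
  proof (rule vnorm_le_one)
    have sq: "vnorm A (a \<otimes> a) \<le> 1" using a a1 vnorm_nonneg[of a] by (simp add: vnorm_square power_le_one)
    show "sa (2 \<odot> (a \<otimes> a) \<ominus> \<one>)" using a by (simp add: minus_smult)
    fix e :: real assume e: "e > 0"
    then have e4: "e / 4 > 0" by simp
    obtain c where c: "sa c" and comm: "\<forall>b\<in>carrier A. b \<otimes> (a \<otimes> a) = a \<otimes> a \<otimes> b \<longrightarrow> b \<otimes> c = c \<otimes> b"
      and le: "vnorm A (c \<otimes> c \<ominus> (\<one> \<ominus> a \<otimes> a)) \<le> e / 4"
      using approx_sqrt[OF sa_intros(4)[OF a] sq e4] by blast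
    have ac: "c \<otimes> a = a \<otimes> c" using comm[rule_format, of a] a by (simp add: m_assoc)
    note w = ac word_eq[OF ac]
    let ?d = "2 \<odot> (a \<otimes> c)"
    have "sa ?d" using a c ac sa_mult[of a c] by simp
    moreover have "(2 \<odot> (a \<otimes> a) \<ominus> \<one>) \<otimes> ?d = ?d \<otimes> (2 \<odot> (a \<otimes> a) \<ominus> \<one>)"
      using a c w by (intro pairing_eqI) (simp_all add: expand)
    moreover have "vnorm A ((2 \<odot> (a \<otimes> a) \<ominus> \<one>) \<otimes> (2 \<odot> (a \<otimes> a) \<ominus> \<one>) \<oplus> ?d \<otimes> ?d \<ominus> \<one>) \<le> e"
    proof -
      have "(2 \<odot> (a \<otimes> a) \<ominus> \<one>) \<otimes> (2 \<odot> (a \<otimes> a) \<ominus> \<one>) \<oplus> ?d \<otimes> ?d \<ominus> \<one> =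
          4 \<odot> (a \<otimes> a \<otimes> (c \<otimes> c \<ominus> (\<one> \<ominus> a \<otimes> a)))"
        using a c w by (intro pairing_eqI) (simp_all add: expand field_simps)
      moreover have "vnorm A (a \<otimes> a \<otimes> (c \<otimes> c \<ominus> (\<one> \<ominus> a \<otimes> a))) \<le> 1 * (e / 4)"
        using a c e by (intro order_trans[OF vnorm_mult] mult_mono sq le vnorm_nonneg) simp_all
      ultimately show ?thesis using a c by (simp add: vnorm_smult)
    qed
    ultimately show "\<exists>d. sa d \<and> (2 \<odot> (a \<otimes> a) \<ominus> \<one>) \<otimes> d = d \<otimes> (2 \<odot> (a \<otimes> a) \<ominus> \<one>) \<and>
        vnorm A ((2 \<odot> (a \<otimes> a) \<ominus> \<one>) \<otimes> (2 \<odot> (a \<otimes> a) \<ominus> \<one>) \<oplus> d \<otimes> d \<ominus> \<one>) \<le> e"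
      by blast
  qed
  show ?thesis
  proof (cases "s = 0")
    case True
    then have "a = \<zero>" using s a vnorm_nonneg[of a] vnorm_eq_zero[of a] by simp
    then show ?thesis using True by (simp add: minus_smult)
  next
    case False
    then have "s > 0" using s a vnorm_nonneg[of a] by simp
    define b where "b = complex_of_real (1 / s) \<odot> a"
    have b: "sa b" "vnorm A b \<le> 1"
      using a s \<open>s > 0\<close> by (simp_all add: b_def vnorm_smult norm_divide)
    have "2 \<odot> (a \<otimes> a) \<ominus> complex_of_real (s\<^sup>2) \<odot> \<one> =
        complex_of_real (s\<^sup>2) \<odot> (2 \<odot> (b \<otimes> b) \<ominus> \<one>)"
      using a False by (intro pairing_eqI) (simp_all add: b_def expand field_simps power2_eq_square)
    then show ?thesis
      using unit[OF b] b mult_left_mono[of _ 1 "s\<^sup>2"] by (simp add: vnorm_smult norm_power)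
  qed
qed

end

section \<open>Midpoints and convexity\<close>

context complex_normed_space
begin

lemma linear_extreme_pointD:
  assumes x: "linear_extreme_point X (unit_ball X) x" and y: "y \<in> carrier X"
    and p: "vnorm X (x \<oplus> y) \<le> 1" and m: "vnorm X (x \<oplus> (-1) \<odot> y) \<le> 1"
  shows "y = \<zero>"
proof -
  have xc: "x \<in> carrier X" using x by (simp add: linear_extreme_point_def unit_ball_def)
  have "x = complex_of_real (1 - 1/2) \<odot> (x \<oplus> y) \<oplus> complex_of_real (1/2) \<odot> (x \<oplus> (-1) \<odot> y)"
    using xc y by (intro pairing_eqI) (simp_all add: pairing_add pairing_smult field_simps)
  then have eq: "x \<oplus> y = x \<oplus> (-1) \<odot> y"
    using x p m xc y unfolding linear_extreme_point_def
    by (elim conjE ballE allE[of _ "1/2"]) (auto simp: unit_ball_def)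
  show ?thesis
  proof (rule pairing_eqI)
    fix f show "pairing y f = pairing \<zero> f"
      using arg_cong[OF eq, of "\<lambda>v. pairing v f"] xc y
      by (simp add: pairing_add pairing_smult pairing_zero)
  qed (use y in simp_all)
qed

lemma vnorm_add_scaled:
  assumes "x \<in> carrier X" "y \<in> carrier X" "vnorm X x \<le> M" "vnorm X (x \<oplus> y) \<le> M"
    "0 \<le> r" "r \<le> 1"
  shows "vnorm X (x \<oplus> complex_of_real r \<odot> y) \<le> M"
proof -
  have "x \<oplus> complex_of_real r \<odot> y = complex_of_real (1 - r) \<odot> x \<oplus> complex_of_real r \<odot> (x \<oplus> y)"
    using assms by (intro pairing_eqI) (simp_all add: pairing_add pairing_smult algebra_simps)
  then have "vnorm X (x \<oplus> complex_of_real r \<odot> y) \<le> (1 - r) * vnorm X x + r * vnorm X (x \<oplus> y)"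
    using vnorm_triangle[of "complex_of_real (1 - r) \<odot> x" "complex_of_real r \<odot> (x \<oplus> y)"] assms
    by (simp add: vnorm_smult del: of_real_diff)
  also have "\<dots> \<le> (1 - r) * M + r * M"
    using assms by (intro add_mono mult_left_mono) auto
  finally show ?thesis by (simp add: algebra_simps)
qed

end

section \<open>Quantitative estimates in place of functional calculus\<close>

context unital_cstar_algebra
begin

lemma vnorm_neg [simp]: "x \<in> carrier A \<Longrightarrow> vnorm A ((-1) \<odot> x) = vnorm A x"
  by (simp add: vnorm_smult)

text \<open>
  Spectrally \<open>T\<^sup>2 = (1 + T\<^sup>2) \<cdot> T\<^sup>2 / (1 + T\<^sup>2)\<close>, where the last factor has norm less than
  \<open>(vnorm A T)\<^sup>2\<close>; here \<open>T\<^sup>2 - T\<^sup>4\<close> approximates it. The factor \<open>q\<close> allows \<open>1 + T\<^sup>2\<close> to be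
  small on a corner only.
\<close>

lemma small_of_corner:
  assumes T: "sa T" and T1: "vnorm A T \<le> 1/2" and q: "q \<in> carrier A"
    and low: "(vnorm A T)\<^sup>2 \<le> vnorm A (q \<otimes> (T \<otimes> T))"
    and up: "vnorm A (q \<oplus> q \<otimes> (T \<otimes> T)) \<le> 1 + \<eta>" and \<eta>: "0 \<le> \<eta>"
  shows "(vnorm A T)\<^sup>2 \<le> 4 * \<eta>"
proof -
  define v where "v = (vnorm A T)\<^sup>2"
  define \<rho> where "\<rho> = vnorm A (q \<otimes> (T \<otimes> T))"
  have v: "0 \<le> v" "v \<le> 1/4"
    using power_mono[OF T1, of 2] vnorm_nonneg[of T] T by (simp_all add: v_def power2_eq_square)
  define D where "D = 2 \<odot> (T \<otimes> T) \<ominus> complex_of_real v \<odot> \<one>"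
  have D: "D \<in> carrier A" using T by (simp add: D_def)
  have Dn: "vnorm A D \<le> v" using square_centred[OF T order_refl] by (simp add: D_def v_def)
  define E where "E = T \<otimes> T \<ominus> T \<otimes> T \<otimes> (T \<otimes> T)"
  have E: "E \<in> carrier A" using T by (simp add: E_def)
  \<comment> \<open>Substituting T^2 = (D + v)/2. The scalar coefficients of 1 and D are nonnegative
    for v \<le> 1/4, so the triangle inequality gives v - v^2/2: weaker than the spectral value v -
    v^2, but still below v by a quadratic term.\<close>
  have "E = complex_of_real (v/2 - v\<^sup>2/4) \<odot> \<one> \<oplus> (complex_of_real (1/2 - v/2) \<odot> D \<oplus> (-1/4) \<odot> (D \<otimes> D))"
    using T by (intro pairing_eqI) (simp_all add: E_def D_def expand field_simps power2_eq_square)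
  then have "vnorm A E \<le> vnorm A (complex_of_real (v/2 - v\<^sup>2/4) \<odot> \<one>) +
      (vnorm A (complex_of_real (1/2 - v/2) \<odot> D) + vnorm A ((-1/4) \<odot> (D \<otimes> D)))"
    using D vnorm_triangle[of "complex_of_real (1/2 - v/2) \<odot> D" "(-1/4) \<odot> (D \<otimes> D)"]
    by (auto intro!: order_trans[OF vnorm_triangle])
  also have "\<dots> \<le> (v/2 - v\<^sup>2/4) * 1 + ((1/2 - v/2) * v + (1/4) * (v * v))"
  proof (intro add_mono)
    have "v\<^sup>2 \<le> v * 1" unfolding power2_eq_square using v by (intro mult_left_mono) auto
    then have p: "0 \<le> v/2 - v\<^sup>2/4" using v by simp
    have "vnorm A (complex_of_real (v/2 - v\<^sup>2/4) \<odot> \<one>) = (v/2 - v\<^sup>2/4) * vnorm A \<one>"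
      using p by (simp only: vnorm_smult one_closed norm_of_real abs_of_nonneg)
    also have "\<dots> \<le> (v/2 - v\<^sup>2/4) * 1" by (intro mult_left_mono vnorm_one p)
    finally show "vnorm A (complex_of_real (v/2 - v\<^sup>2/4) \<odot> \<one>) \<le> (v/2 - v\<^sup>2/4) * 1" .
    have p: "0 \<le> 1/2 - v/2" using v by simp
    have "vnorm A (complex_of_real (1/2 - v/2) \<odot> D) = (1/2 - v/2) * vnorm A D"
      using p D by (simp only: vnorm_smult norm_of_real abs_of_nonneg)
    also have "\<dots> \<le> (1/2 - v/2) * v" by (intro mult_left_mono Dn p)
    finally show "vnorm A (complex_of_real (1/2 - v/2) \<odot> D) \<le> (1/2 - v/2) * v" .
    have "vnorm A (D \<otimes> D) \<le> v * v"
      using D v by (intro order_trans[OF vnorm_mult] mult_mono Dn vnorm_nonneg) auto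
    then show "vnorm A ((-1/4) \<odot> (D \<otimes> D)) \<le> (1/4) * (v * v)"
      using D by (simp add: vnorm_smult)
  qed
  also have "\<dots> = v - v\<^sup>2/2" by (simp add: power2_eq_square algebra_simps)
  finally have En: "vnorm A E \<le> v - v\<^sup>2/2" .
  \<comment> \<open>From (1 + T^2)(T^2 - T^4) = T^2 - T^6; the remainder carries the factor T^4 of
    norm v^2.\<close>
  have "q \<otimes> (T \<otimes> T) = (q \<oplus> q \<otimes> (T \<otimes> T)) \<otimes> E \<oplus> q \<otimes> (T \<otimes> T) \<otimes> (T \<otimes> T \<otimes> (T \<otimes> T))"
    using T q by (intro pairing_eqI) (simp_all add: E_def expand)
  then have "\<rho> \<le> vnorm A ((q \<oplus> q \<otimes> (T \<otimes> T)) \<otimes> E) + vnorm A (q \<otimes> (T \<otimes> T) \<otimes> (T \<otimes> T \<otimes> (T \<otimes> T)))"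
    unfolding \<rho>_def using T q E
      vnorm_triangle[of "(q \<oplus> q \<otimes> (T \<otimes> T)) \<otimes> E" "q \<otimes> (T \<otimes> T) \<otimes> (T \<otimes> T \<otimes> (T \<otimes> T))"] by simp
  also have "\<dots> \<le> (1 + \<eta>) * (v - v\<^sup>2/2) + \<rho> * v\<^sup>2"
  proof (rule add_mono)
    show "vnorm A ((q \<oplus> q \<otimes> (T \<otimes> T)) \<otimes> E) \<le> (1 + \<eta>) * (v - v\<^sup>2/2)"
      using T q E \<eta> by (intro order_trans[OF vnorm_mult] mult_mono up En vnorm_nonneg) auto
    have "vnorm A (T \<otimes> T \<otimes> (T \<otimes> T)) = v\<^sup>2"
      using T by (simp add: vnorm_square v_def)
    then show "vnorm A (q \<otimes> (T \<otimes> T) \<otimes> (T \<otimes> T \<otimes> (T \<otimes> T))) \<le> \<rho> * v\<^sup>2"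
      using vnorm_mult[of "q \<otimes> (T \<otimes> T)" "T \<otimes> T \<otimes> (T \<otimes> T)"] T q by (simp add: \<rho>_def)
  qed
  finally have "\<rho> * (1 - v\<^sup>2) \<le> (1 + \<eta>) * (v - v\<^sup>2/2)" by (simp add: algebra_simps)
  moreover have v2: "v * v \<le> v * (1/4)" using v by (intro mult_left_mono) auto
  moreover have "v * (1 - v\<^sup>2) \<le> \<rho> * (1 - v\<^sup>2)"
    using low v v2
    unfolding v_def[symmetric] \<rho>_def by (intro mult_right_mono) (auto simp: power2_eq_square)
  ultimately have "v * (1 - v\<^sup>2) \<le> (1 + \<eta>) * (v - v\<^sup>2/2)" by linarith
  also have "\<dots> = v * ((1 + \<eta>) * (1 - v/2))" by (simp add: field_simps power2_eq_square)
  finally have "v * (1 - v\<^sup>2) \<le> v * ((1 + \<eta>) * (1 - v/2))" .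
  then have "v = 0 \<or> 1 - v\<^sup>2 \<le> (1 + \<eta>) * (1 - v/2)"
    using v by (auto simp: mult_le_cancel_left)
  then show ?thesis
  proof
    \<comment> \<open>This amounts to v/2 - v^2 \<le> \<eta> (1 - v/2). Since v \<le> 1/4 bounds v^2
      by v/4, the left side is at least v/4, whence the factor 4.\<close>
    assume "1 - v\<^sup>2 \<le> (1 + \<eta>) * (1 - v/2)"
    then have "v/2 - v * v \<le> \<eta> - \<eta> * v/2" by (simp add: algebra_simps power2_eq_square)
    moreover have "0 \<le> \<eta> * v" using \<eta> v by simp
    ultimately show ?thesis using v2 by (simp add: v_def[symmetric])
  qed (use \<eta> in \<open>simp add: v_def\<close>)
qed

text \<open>
  A substitute for the positivity of \<open>w\<^sup>* w\<close>, which is only known here for self-adjoint \<open>w\<close>: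
  \<open>w\<^sup>* w + w w\<^sup>*\<close> is twice the sum of the squares of the real and imaginary parts of \<open>w\<close>.
\<close>

lemma sum_of_squares_zero:
  assumes w: "w \<in> carrier A" and p: "sa p" and k: "sa k"
    and eq: "adj A w \<otimes> w \<oplus> w \<otimes> adj A w = (-1) \<odot> (p \<otimes> p \<oplus> k \<otimes> k)"
  shows "p = \<zero>"
proof (rule ccontr)
  assume "p \<noteq> \<zero>"
  then have np: "vnorm A p > 0" using p vnorm_nonneg[of p] vnorm_eq_zero[of p] by simp
  define a where "a = (1/2) \<odot> (w \<oplus> adj A w)"
  define b where "b = (-\<i>/2) \<odot> (w \<oplus> (-1) \<odot> adj A w)"
  have sa: "sa a" "sa b" using w unfolding sa_def by (auto simp: a_def b_def smult_add a_comm)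
  have ab: "adj A w \<otimes> w \<oplus> w \<otimes> adj A w = 2 \<odot> (a \<otimes> a) \<oplus> 2 \<odot> (b \<otimes> b)"
    using w by (intro pairing_eqI) (simp_all add: a_def b_def expand field_simps)
  \<comment> \<open>A common bound that lets \<open>square_centred\<close> apply to
    \<open>a\<close>, \<open>b\<close> and \<open>k\<close>; the summand with \<open>p\<close>
    ensures that the rescaled \<open>T\<close> below has norm at most 1/2.\<close>
  define s where "s = vnorm A a + vnorm A b + vnorm A k + 2 * vnorm A p"
  have nn: "0 \<le> vnorm A a" "0 \<le> vnorm A b" "0 \<le> vnorm A k"
    using sa k by (simp_all add: vnorm_nonneg)
  have s: "vnorm A a \<le> s" "vnorm A b \<le> s" "vnorm A k \<le> s" "2 * vnorm A p \<le> s" "s > 0"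
    using nn np by (simp_all add: s_def)
  define c where "c u = 2 \<odot> (u \<otimes> u) \<ominus> complex_of_real (s\<^sup>2) \<odot> \<one>" for u
  have c: "c a \<in> carrier A" "c b \<in> carrier A" "c k \<in> carrier A"
    using sa k by (simp_all add: c_def)
  have cn: "vnorm A (c a) \<le> s\<^sup>2" "vnorm A (c b) \<le> s\<^sup>2" "vnorm A (c k) \<le> s\<^sup>2"
    unfolding c_def using sa k s by (simp_all add: square_centred del: of_real_power)
  \<comment> \<open>The constant 5/2 = 1 + 1 + 1/2 collects the shifts in \<open>c a\<close>,
    \<open>c b\<close> and half of \<open>c k\<close>. The centred terms have total norm at most 5/2
    s^2, so adding the square of \<open>p\<close> to that multiple of the unit does not raise the
    norm bound.\<close>
  have "p \<otimes> p \<oplus> complex_of_real (5/2 * s\<^sup>2) \<odot> \<one> = (-1) \<odot> (c a \<oplus> (c b \<oplus> (1/2) \<odot> c k))"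
  proof (rule pairing_eqI)
    fix f
    have pp: "pairing (p \<otimes> p) f =
        - pairing (k \<otimes> k) f - 2 * pairing (a \<otimes> a) f - 2 * pairing (b \<otimes> b) f"
      using arg_cong[OF trans[OF ab[symmetric] eq], of "\<lambda>v. pairing v f"] sa k p
      by (simp add: expand algebra_simps)
    show "pairing (p \<otimes> p \<oplus> complex_of_real (5/2 * s\<^sup>2) \<odot> \<one>) f =
        pairing ((-1) \<odot> (c a \<oplus> (c b \<oplus> (1/2) \<odot> c k))) f"
      using sa k p by (simp add: c_def expand pp field_simps)
  qed (use sa k p c in simp_all)
  then have le: "vnorm A (p \<otimes> p \<oplus> complex_of_real (5/2 * s\<^sup>2) \<odot> \<one>) \<le> 5/2 * s\<^sup>2"
    using vnorm_triangle[of "c a" "c b \<oplus> (1/2) \<odot> c k"] vnorm_triangle[of "c b" "(1/2) \<odot> c k"]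
      c cn vnorm_smult[of "c k" "1/2"] by (simp add: norm_divide)
  \<comment> \<open>Scales the preceding bound to: 1 + T^2 has norm at most 1. Then
    \<open>small_of_corner\<close> with the unit as \<open>q\<close> and \<eta> = 0 yields T =
    0.\<close>
  define \<kappa> where "\<kappa> = sqrt (2/5) / s"
  have \<kappa>: "\<kappa> > 0" "\<kappa>\<^sup>2 = 2 / (5 * s\<^sup>2)" using s by (simp_all add: \<kappa>_def power_divide)
  define T where "T = complex_of_real \<kappa> \<odot> p"
  have T: "sa T" using p by (simp add: T_def)
  have nT: "vnorm A T = \<kappa> * vnorm A p" using p \<kappa> by (simp add: T_def vnorm_smult)
  have "\<kappa> * vnorm A p \<le> \<kappa> * (s/2)" using s \<kappa> by (intro mult_left_mono) auto
  also have "\<dots> = sqrt (2/5) / 2" using s by (simp add: \<kappa>_def)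
  also have "\<dots> \<le> 1/2" by simp
  finally have T1: "vnorm A T \<le> 1/2" by (simp add: nT)
  have "complex_of_real \<kappa> * complex_of_real \<kappa> = complex_of_real (2 / (5 * s\<^sup>2))"
    unfolding of_real_mult[symmetric] using \<kappa>(2) by (simp only: power2_eq_square)
  then have TT: "T \<otimes> T = complex_of_real (2 / (5 * s\<^sup>2)) \<odot> (p \<otimes> p)"
    using p by (simp add: T_def smult_mult_left smult_mult_right)
  have "\<one> \<oplus> \<one> \<otimes> (T \<otimes> T) =
      complex_of_real (2 / (5 * s\<^sup>2)) \<odot> (p \<otimes> p \<oplus> complex_of_real (5/2 * s\<^sup>2) \<odot> \<one>)"
    unfolding TT using p s by (intro pairing_eqI) (simp_all add: expand field_simps)
  then have "vnorm A (\<one> \<oplus> \<one> \<otimes> (T \<otimes> T)) = 2 / (5 * s\<^sup>2) *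
      vnorm A (p \<otimes> p \<oplus> complex_of_real (5/2 * s\<^sup>2) \<odot> \<one>)"
    using p s by (simp only: vnorm_smult a_closed sa_closed smult_in one_closed m_closed norm_of_real) simp
  also have "\<dots> \<le> 2 / (5 * s\<^sup>2) * (5/2 * s\<^sup>2)"
    using s by (intro mult_left_mono le) auto
  also have "\<dots> = 1 + 0" using s by simp
  finally have "(vnorm A T)\<^sup>2 \<le> 4 * 0"
    using T by (intro small_of_corner[OF T T1 one_closed]) (simp_all add: vnorm_square)
  then show False using nT \<kappa> np by simp
qed


lemma vnorm_product_le:
  assumes "x \<in> carrier A" "y \<in> carrier A" "vnorm A x \<le> r" "vnorm A y \<le> s"
  shows "vnorm A (x \<otimes> y) \<le> r * s"
  using assms vnorm_nonneg[of x] vnorm_nonneg[of y]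
  by (intro order_trans[OF vnorm_mult] mult_mono) auto

text \<open>
  This is the scalar estimate \<open>t (1 + (1 - t\<^sup>2)\<^sup>2 / 16) \<le> 1\<close> on \<open>[-1, 1]\<close>. With \<open>s = h\<^sup>2\<close> the square
  of the left-hand side is \<open>1 - r (1 - s m)\<close>, and both factors have approximate square roots.
\<close>

lemma perturbation_le_one:
  assumes h: "sa h" and h1: "vnorm A h \<le> 1"
  defines "r \<equiv> \<one> \<ominus> h \<otimes> h"
  shows "vnorm A (h \<otimes> (\<one> \<oplus> (1/16) \<odot> (r \<otimes> r))) \<le> 1"
proof -
  let ?s = "h \<otimes> h"
  have s: "sa ?s" "vnorm A ?s \<le> 1"
    using h h1 vnorm_nonneg[of h] by (simp_all add: vnorm_square power_le_one)
  have r: "sa r" using h by (simp add: r_def minus_smult)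
  have r2: "vnorm A r \<le> 2"
    unfolding r_def using vnorm_minus_le[of \<one> ?s] vnorm_one s h by simp
  have hr: "r \<otimes> h = h \<otimes> r"
    using h by (simp add: r_def minus_smult l_distr r_distr smult_mult_left smult_mult_right m_assoc)
  \<comment> \<open>With s = 1 - r, expanding (1 - r)(1 + r^2/16)^2 gives 1 - r + s (r^2/8 +
    r^4/256); factoring out r leaves this \<open>m\<close>. As \<open>r\<close> has norm at most 2,
    \<open>m\<close> has norm at most 1/4 + 1/32, small enough for \<open>approx_sqrt\<close> to
    apply to \<open>g\<close>.\<close>
  define m where "m = (1/8) \<odot> r \<oplus> (1/256) \<odot> (r \<otimes> (r \<otimes> r))"
  have m: "m \<in> carrier A" using r by (simp add: m_def)
  have hm: "m \<otimes> h = h \<otimes> m"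
    using h r by (simp add: m_def l_distr r_distr smult_mult_left smult_mult_right m_assoc hr
        word_eq[OF hr])
  have sam: "sa m"
    using r unfolding m_def by (intro sa_intros sa_mult) (simp_all add: m_assoc)
  define g where "g = ?s \<otimes> m"
  have hg: "h \<otimes> g = g \<otimes> h"
    using h m hm by (simp add: g_def m_assoc)
  have g: "sa g"
    unfolding g_def using s sam h m hm word_eq[OF hm] by (intro sa_mult) (simp_all add: m_assoc)
  have "vnorm A (r \<otimes> (r \<otimes> r)) \<le> 2 * (2 * 2)"
    using r r2 by (intro vnorm_product_le) auto
  then have "vnorm A m \<le> 1"
    unfolding m_def
    using vnorm_triangle[of "(1/8) \<odot> r" "(1/256) \<odot> (r \<otimes> (r \<otimes> r))"] r r2
    by (simp add: vnorm_smult norm_divide)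
  then have g1: "vnorm A g \<le> 1"
    unfolding g_def using vnorm_product_le[of ?s m 1 1] h m s by simp
  let ?b = "h \<otimes> (\<one> \<oplus> (1/16) \<odot> (r \<otimes> r))"
  have b: "sa ?b"
    using h r word_eq[OF hr] hr
    by (intro sa_mult) (simp_all add: l_distr r_distr smult_mult_left smult_mult_right m_assoc)
  have hh: "pairing (?b \<otimes> ?b) f = pairing (\<one> \<ominus> r \<otimes> (\<one> \<ominus> g)) f" for f
  proof -
    have ss: "?s = \<one> \<ominus> r"
      using h by (intro pairing_eqI) (simp_all add: r_def expand)
    have rw: "h \<otimes> (h \<otimes> z) = z \<ominus> r \<otimes> z" if "z \<in> carrier A" for z
      using that word_eq[OF ss, of z] h r
      by (simp add: minus_smult l_distr smult_mult_left)
    show ?thesis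
      using h r by (simp add: g_def m_def expand hr word_eq[OF hr] rw ss field_simps)
  qed
  show ?thesis
  proof (rule vnorm_le_one[OF b])
    fix e :: real assume e: "e > 0"
    \<comment> \<open>The final defect is E k^2 + r F, where k^2 has norm at most 3 and
      \<open>r\<close> at most 2, so it is bounded by 3 e' + 2 e'.\<close>
    define e' where "e' = min 1 (e/5)"
    have e': "e' > 0" "e' \<le> 1" "5 * e' \<le> e" using e by (auto simp: e'_def)
    obtain c where c: "sa c"
      and c_comm: "\<forall>z\<in>carrier A. z \<otimes> ?s = ?s \<otimes> z \<longrightarrow> z \<otimes> c = c \<otimes> z"
      and c_le: "vnorm A (c \<otimes> c \<ominus> (\<one> \<ominus> ?s)) \<le> e'"
      using approx_sqrt[OF s e'(1)] by blast
    obtain k where k: "sa k"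
      and k_comm: "\<forall>z\<in>carrier A. z \<otimes> g = g \<otimes> z \<longrightarrow> z \<otimes> k = k \<otimes> z"
      and k_le: "vnorm A (k \<otimes> k \<ominus> (\<one> \<ominus> g)) \<le> e'"
      using approx_sqrt[OF g g1 e'(1)] by blast
    \<comment> \<open>Commutation passes through \<open>approx_sqrt\<close>: \<open>h\<close>
      commutes with its square and with \<open>g\<close>, hence with \<open>c\<close> and
      \<open>k\<close>; then \<open>c\<close> commutes with \<open>g\<close> and therefore with
      \<open>k\<close>.\<close>
    have hc: "h \<otimes> c = c \<otimes> h" using c_comm[rule_format, of h] h by (simp add: m_assoc)
    have hk: "h \<otimes> k = k \<otimes> h" using k_comm[rule_format, of h] h hg by simp
    have rc: "r \<otimes> c = c \<otimes> r"
      using h c hc word_eq[OF hc]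
      by (simp add: r_def minus_smult l_distr r_distr smult_mult_left smult_mult_right m_assoc)
    have "c \<otimes> g = g \<otimes> c"
      using h c r hc rc word_eq[OF hc] word_eq[OF rc]
      by (simp add: g_def m_def minus_smult l_distr r_distr smult_mult_left smult_mult_right m_assoc)
    then have ck: "c \<otimes> k = k \<otimes> c" using k_comm[rule_format, of c] c by simp
    have rk: "r \<otimes> k = k \<otimes> r"
      using h k hk word_eq[OF hk]
      by (simp add: r_def minus_smult l_distr r_distr smult_mult_left smult_mult_right m_assoc)
    \<comment> \<open>The square of c is close to 1 - s = r and that of k to 1 - g, so the square of
      their product is close to r (1 - g), the complement of the square of
      \<open>?b\<close>.\<close>
    let ?d = "c \<otimes> k"
    have d: "sa ?d" using c k ck by (rule sa_mult)
    have bd: "?b \<otimes> ?d = ?d \<otimes> ?b"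
      using h r c k by (simp add: l_distr r_distr smult_mult_left smult_mult_right m_assoc
          hc hk rc rk word_eq[OF hc] word_eq[OF hk] word_eq[OF rc] word_eq[OF rk])
    define E where "E = c \<otimes> c \<ominus> (\<one> \<ominus> ?s)"
    define F where "F = k \<otimes> k \<ominus> (\<one> \<ominus> g)"
    have EF: "E \<in> carrier A" "F \<in> carrier A" "vnorm A E \<le> e'" "vnorm A F \<le> e'"
      using c k g h c_le k_le by (simp_all add: E_def F_def)
    have kk: "k \<otimes> k = F \<oplus> (\<one> \<ominus> g)"
      using k g by (intro pairing_eqI) (simp_all add: F_def expand)
    have cc: "c \<otimes> c = E \<oplus> r"
      using c h by (intro pairing_eqI) (simp_all add: E_def r_def expand)
    have "vnorm A (k \<otimes> k) \<le> vnorm A F + (vnorm A \<one> + vnorm A g)"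
      unfolding kk using EF g
      by (intro order_trans[OF vnorm_triangle] add_left_mono vnorm_minus_le) auto
    then have k3: "vnorm A (k \<otimes> k) \<le> 3" using EF vnorm_one g1 e' by simp
    have dd: "?d \<otimes> ?d = (E \<oplus> r) \<otimes> (k \<otimes> k)"
      using c k unfolding cc[symmetric] by (simp add: m_assoc ck word_eq[OF ck])
    have "?b \<otimes> ?b \<oplus> ?d \<otimes> ?d \<ominus> \<one> = E \<otimes> (k \<otimes> k) \<oplus> r \<otimes> F"
    proof (rule pairing_eqI)
      fix f
      have "pairing (r \<otimes> (k \<otimes> k)) f = pairing (r \<otimes> F \<oplus> r \<otimes> (\<one> \<ominus> g)) f"
        unfolding kk using EF r g by (simp add: r_distr)
      then show "pairing (?b \<otimes> ?b \<oplus> ?d \<otimes> ?d \<ominus> \<one>) f = pairing (E \<otimes> (k \<otimes> k) \<oplus> r \<otimes> F) f"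
        unfolding dd using EF r g k b hh[of f]
        by (simp add: l_distr minus_smult pairing_add pairing_smult)
    qed (use EF r g k b d in simp_all)
    moreover have "vnorm A (E \<otimes> (k \<otimes> k) \<oplus> r \<otimes> F) \<le> e' * 3 + 2 * e'"
      using EF r r2 k k3
      by (intro order_trans[OF vnorm_triangle] add_mono vnorm_product_le) auto
    ultimately have "vnorm A (?b \<otimes> ?b \<oplus> ?d \<otimes> ?d \<ominus> \<one>) \<le> e" using e' by simp
    then show "\<exists>d. sa d \<and> ?b \<otimes> d = d \<otimes> ?b \<and> vnorm A (?b \<otimes> ?b \<oplus> d \<otimes> d \<ominus> \<one>) \<le> e"
      using d bd by blast
  qed
qed

end

section \<open>Extreme points of the unit ball of a C*-algebra\<close>

context unital_cstar_algebra
begin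

lemma adj_mult_self_le_one: "x \<in> unit_ball A \<Longrightarrow> vnorm A (adj A x \<otimes> x) \<le> 1"
  using vnorm_nonneg[of x] by (auto simp: unit_ball_def cstar_identity power_le_one)

lemma vnorm_le_oneI:
  assumes "x \<in> carrier A" "vnorm A (adj A x \<otimes> x) \<le> 1"
  shows "vnorm A x \<le> 1"
  using vnorm_le_iff_adj_mult[of x 1] assms by simp

text \<open>Perturb \<open>x\<close> by y = (i/4) x r with r = 1 - h^2. The factor i cancels the
  cross terms in \<open>adj A (x \<oplus> y) \<otimes> (x \<oplus> y)\<close>, leaving h (1 +
  r^2/16), and \<open>perturbation_le_one\<close> keeps x + y and x - y in the ball. Extremeness
  gives x r = 0, so h^3 = h; what remains is to exclude the spectral value -1 of
  \<open>h\<close>.\<close>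

lemma extreme_partial_isometry:
  assumes x: "linear_extreme_point A (unit_ball A) x"
  shows "x \<otimes> (adj A x \<otimes> x) = x"
proof -
  have xb: "x \<in> unit_ball A" using x by (simp add: linear_extreme_point_def)
  then have xc: "x \<in> carrier A" by (simp add: unit_ball_def)
  define h where "h = adj A x \<otimes> x"
  have h: "sa h" "vnorm A h \<le> 1" using xc adj_mult_self_le_one[OF xb] by (simp_all add: h_def)
  define r where "r = \<one> \<ominus> h \<otimes> h"
  have r: "sa r" using h by (simp add: r_def minus_smult)
  have hr: "r \<otimes> h = h \<otimes> r"
    using h by (simp add: r_def minus_smult l_distr r_distr smult_mult_left smult_mult_right m_assoc)
  define y where "y = (\<i>/4) \<odot> (x \<otimes> r)"
  have y: "y \<in> carrier A" using xc r by (simp add: y_def)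
  have *: "vnorm A (x \<oplus> c \<odot> y) \<le> 1" if c: "c = 1 \<or> c = -1" for c :: complex
  proof (rule vnorm_le_oneI)
    have "adj A (x \<oplus> c \<odot> y) \<otimes> (x \<oplus> c \<odot> y) = h \<otimes> (\<one> \<oplus> (1/16) \<odot> (r \<otimes> r))"
      using xc r c h(1) word_eq[OF hr] word_eq[OF h_def[symmetric]]
      by (intro pairing_eqI) (auto simp: y_def expand h_def[symmetric] hr field_simps)
    then show "vnorm A (adj A (x \<oplus> c \<odot> y) \<otimes> (x \<oplus> c \<odot> y)) \<le> 1"
      using perturbation_le_one[OF h] by (simp add: r_def)
  qed (use xc y in simp)
  have "y = \<zero>" using linear_extreme_pointD[OF x y] *[of 1] *[of "-1"] y by simp
  moreover have "x \<otimes> r = (-4 * \<i>) \<odot> y" using xc r by (simp add: y_def)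
  ultimately have "x \<otimes> r = \<zero>" by simp
  have xhh: "x \<otimes> (h \<otimes> h) = x"
  proof (rule pairing_eqI)
    fix f show "pairing (x \<otimes> (h \<otimes> h)) f = pairing x f"
      using arg_cong[OF \<open>x \<otimes> r = \<zero>\<close>, of "\<lambda>v. pairing v f"] xc h
      by (simp add: r_def expand)
  qed (use xc h in simp_all)
  then have hhh: "h \<otimes> (h \<otimes> h) = h"
    using xc h by (simp add: h_def m_assoc)
  \<comment> \<open>The spectral projection of \<open>h\<close> for the value -1. For w = x p one
    gets \<open>adj A w \<otimes> w\<close> = -p, while k = \<open>w \<otimes> adj A w\<close>
    satisfies k^2 = -k. So the sum of the two products is -p + k = -(p^2 + k^2), the situation of
    \<open>sum_of_squares_zero\<close>.\<close>
  define p where "p = (1/2) \<odot> (h \<otimes> h \<ominus> h)"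
  have p: "sa p" using h by (simp add: p_def minus_smult)
  have pp: "p \<otimes> p = p"
    using h hhh word_eq[OF hhh]
    by (intro pairing_eqI) (simp_all add: p_def expand field_simps)
  define w where "w = x \<otimes> p"
  have w: "w \<in> carrier A" using xc p by (simp add: w_def)
  have ww: "adj A w \<otimes> w = (-1) \<odot> p"
  proof -
    have "adj A w \<otimes> w = p \<otimes> (h \<otimes> p)" using xc p by (simp add: w_def h_def m_assoc)
    also have "\<dots> = (-1) \<odot> p"
      using h hhh word_eq[OF hhh]
      by (intro pairing_eqI) (simp_all add: p_def expand field_simps)
    finally show ?thesis .
  qed
  define k where "k = w \<otimes> adj A w"
  have k: "sa k" using w by (simp add: k_def)
  have wp: "w \<otimes> p = w" using xc p pp by (simp add: w_def m_assoc)
  have kk: "k \<otimes> k = (-1) \<odot> k"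
  proof -
    have "k \<otimes> k = w \<otimes> (adj A w \<otimes> w) \<otimes> adj A w" using w by (simp add: k_def m_assoc)
    then show ?thesis
      using w p wp by (simp add: ww smult_mult_left smult_mult_right k_def)
  qed
  have "p = \<zero>"
  proof (rule sum_of_squares_zero[OF w p k])
    show "adj A w \<otimes> w \<oplus> w \<otimes> adj A w = (-1) \<odot> (p \<otimes> p \<oplus> k \<otimes> k)"
      unfolding ww pp kk k_def[symmetric]
      using p k by (intro pairing_eqI) (simp_all add: expand)
  qed
  have "h \<otimes> h = h"
  proof (rule pairing_eqI)
    fix f show "pairing (h \<otimes> h) f = pairing h f"
      using arg_cong[OF \<open>p = \<zero>\<close>, of "\<lambda>v. pairing v f"] h by (simp add: p_def expand)
  qed (use h in simp_all)
  then show ?thesis using xhh by (simp add: h_def)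
qed

text \<open>The element in question is orthogonal to \<open>x\<close> on both sides. Adding or
  subtracting a small multiple \<open>v\<close> of it turns \<open>adj A x \<otimes> x\<close> into
  the orthogonal sum with \<open>adj A v \<otimes> v\<close>, whose norm is still at most 1, so
  extremeness makes it vanish.\<close>

lemma extreme_annihilates:
  assumes x: "linear_extreme_point A (unit_ball A) x" and y: "y \<in> carrier A"
  shows "(\<one> \<ominus> x \<otimes> adj A x) \<otimes> (y \<otimes> (\<one> \<ominus> adj A x \<otimes> x)) = \<zero>"
proof -
  have xb: "x \<in> unit_ball A" using x by (simp add: linear_extreme_point_def)
  then have xc: "x \<in> carrier A" by (simp add: unit_ball_def)
  note xp = extreme_partial_isometry[OF x]
  have xp': "adj A x \<otimes> (x \<otimes> adj A x) = adj A x"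
    using arg_cong[OF xp, of "adj A"] xc by (simp add: m_assoc)
  define z where "z = (\<one> \<ominus> x \<otimes> adj A x) \<otimes> (y \<otimes> (\<one> \<ominus> adj A x \<otimes> x))"
  have z: "z \<in> carrier A" using xc y by (simp add: z_def)
  have xz: "adj A x \<otimes> z = \<zero>"
    using xc y xp' word_eq[OF xp'] m_assoc
    by (intro pairing_eqI) (simp_all add: z_def expand)
  have zx: "z \<otimes> (adj A x \<otimes> x) = \<zero>"
    using xc y xp xp'
    by (intro pairing_eqI) (simp_all add: z_def expand)
  have zx': "adj A z \<otimes> x = \<zero>" using arg_cong[OF xz, of "adj A"] xc z by simp
  have n: "vnorm A z + 1 > 0" using vnorm_nonneg[OF z] by simp
  \<comment> \<open>Dividing by the norm plus 1 avoids a separate case z = 0.\<close>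
  define v where "v = complex_of_real (1 / (vnorm A z + 1)) \<odot> z"
  have v: "v \<in> carrier A" using z by (simp add: v_def)
  have "vnorm A v = vnorm A z / (vnorm A z + 1)"
    unfolding v_def vnorm_smult[OF z] norm_of_real using n by simp
  then have v1: "vnorm A v \<le> 1" using n by (simp add: divide_le_eq)
  have *: "vnorm A (x \<oplus> c \<odot> v) \<le> 1" if c: "c = 1 \<or> c = -1" for c :: complex
  proof (rule vnorm_le_oneI)
    have "adj A (x \<oplus> c \<odot> v) \<otimes> (x \<oplus> c \<odot> v) = adj A x \<otimes> x \<oplus> adj A v \<otimes> v"
      using xc z c xz zx' by (auto simp: v_def l_distr r_distr smult_mult_left smult_mult_right)
    also have "vnorm A \<dots> \<le> 1"
    proof (rule vnorm_orthogonal_sum)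
      have "adj A v \<otimes> v \<otimes> (adj A x \<otimes> x) = \<zero>"
        using xc z zx by (simp add: v_def m_assoc smult_mult_left smult_mult_right)
      moreover have "adj A x \<otimes> x \<otimes> (adj A v \<otimes> v) = adj A (adj A v \<otimes> v \<otimes> (adj A x \<otimes> x))"
        using xc v by simp
      ultimately show "adj A x \<otimes> x \<otimes> (adj A v \<otimes> v) = \<zero>" by simp
      show "vnorm A (adj A v \<otimes> v) \<le> 1"
        using v v1 by (intro adj_mult_self_le_one) (simp add: unit_ball_def)
    qed (use xc v adj_mult_self_le_one[OF xb] in simp_all)
    finally show "vnorm A (adj A (x \<oplus> c \<odot> v) \<otimes> (x \<oplus> c \<odot> v)) \<le> 1" .
  qed (use xc v in simp)
  have "v = \<zero>" using linear_extreme_pointD[OF x v] *[of 1] *[of "-1"] v by simp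
  moreover have "z = complex_of_real (vnorm A z + 1) \<odot> v"
    using z n by (simp add: v_def of_real_mult[symmetric] del: of_real_mult of_real_divide of_real_add)
  ultimately show ?thesis by (simp add: z_def[symmetric])
qed

text \<open>The bound of \<open>small_of_corner\<close> for \<eta> = (1 + t)^2 - 1 = 2 t + t^2,
  after a square root; it is continuous and vanishes at 0.\<close>

definition modulus :: "real \<Rightarrow> real" where
  "modulus t = 2 * sqrt (2 * t + t\<^sup>2)"

lemma small_of_corner':
  assumes "sa T" "vnorm A T \<le> 1/2" "q \<in> carrier A" "(vnorm A T)\<^sup>2 \<le> vnorm A (q \<otimes> (T \<otimes> T))"
    "vnorm A (q \<oplus> q \<otimes> (T \<otimes> T)) \<le> (1 + t)\<^sup>2" "0 \<le> t"
  shows "vnorm A T \<le> modulus t"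
proof -
  have "(vnorm A T)\<^sup>2 \<le> 4 * (2 * t + t\<^sup>2)"
    using assms by (intro small_of_corner) (auto simp: power2_eq_square algebra_simps)
  then have "vnorm A T \<le> sqrt (4 * (2 * t + t\<^sup>2))" by (rule real_le_rsqrt)
  then show ?thesis by (simp only: modulus_def real_sqrt_mult real_sqrt_four)
qed

text \<open>
  Write \<open>y x\<^sup>* = a + i b + u\<close> with \<open>a\<close>, \<open>b\<close> self-adjoint in the corner of \<open>q = x x\<^sup>*\<close> and \<open>q u = 0\<close>.
  The three terms are bounded in turn, \<open>u\<close> through the self-adjoint \<open>u + u\<^sup>*\<close>.
\<close>

lemma corner_small:
  assumes x: "x \<in> carrier A" and x1: "vnorm A x \<le> 1" and iso: "x \<otimes> (adj A x \<otimes> x) = x"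
    and y: "y \<in> carrier A" and y1: "vnorm A y \<le> 1/8" and \<delta>: "0 \<le> \<delta>"
    and p: "vnorm A (x \<oplus> y) \<le> 1 + \<delta>" and m: "vnorm A (x \<oplus> (-1) \<odot> y) \<le> 1 + \<delta>"
  defines "\<alpha> \<equiv> modulus \<delta>"
  defines "\<beta> \<equiv> modulus (\<delta> + \<alpha>)"
  shows "vnorm A (y \<otimes> adj A x) \<le> \<alpha> + \<beta> + modulus (\<delta> + \<alpha> + \<beta>)"
proof -
  define q where "q = x \<otimes> adj A x"
  have q: "sa q" using x by (simp add: q_def)
  have qq: "q \<otimes> q = q" using x iso word_eq[OF iso] by (simp add: q_def m_assoc)
  have q1: "vnorm A q \<le> 1" using vnorm_product_le[of x "adj A x" 1 1] x x1 by (simp add: q_def)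
  define Y where "Y = y \<otimes> adj A x"
  have Y: "Y \<in> carrier A" using x y by (simp add: Y_def)
  have "adj A x \<otimes> (x \<otimes> adj A x) = adj A x"
    using arg_cong[OF iso, of "adj A"] x by (simp add: m_assoc)
  then have Yq: "Y \<otimes> q = Y"
    using x y by (simp add: Y_def q_def m_assoc)
  have Y1: "vnorm A Y \<le> 1/8" using vnorm_product_le[of y "adj A x" "1/8" 1] x x1 y y1 by (simp add: Y_def)
  have qY: "vnorm A (q \<oplus> c \<odot> Y) \<le> 1 + \<delta>" if c: "c = 1 \<or> c = -1" for c :: complex
  proof -
    have "q \<oplus> c \<odot> Y = (x \<oplus> c \<odot> y) \<otimes> adj A x"
      using x y by (simp add: q_def Y_def l_distr smult_mult_left)
    then show ?thesis
      using vnorm_product_le[of "x \<oplus> c \<odot> y" "adj A x" "1 + \<delta>" 1] x x1 y p m c by auto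
  qed
  define W where "W = q \<otimes> Y"
  have W: "W \<in> carrier A" using q Y by (simp add: W_def)
  have qW: "q \<otimes> W = W" using q Y by (simp add: W_def word_eq[OF qq])
  have Wq: "W \<otimes> q = W" using q Y by (simp add: W_def m_assoc Yq)
  have W'q: "adj A W \<otimes> q = adj A W" using arg_cong[OF qW, of "adj A"] q W by simp
  have qW': "q \<otimes> adj A W = adj A W" using arg_cong[OF Wq, of "adj A"] q W by simp
  note rules = qq qW Wq W'q qW' word_eq[OF qq] word_eq[OF qW] word_eq[OF Wq] word_eq[OF W'q] word_eq[OF qW']
  have W1: "vnorm A W \<le> 1/8" using vnorm_product_le[of q Y 1 "1/8"] q q1 Y Y1 by (simp add: W_def)
  have qWn: "vnorm A (q \<oplus> c \<odot> W) \<le> 1 + \<delta>" if c: "c = 1 \<or> c = -1" for c :: complex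
  proof -
    have "q \<oplus> c \<odot> W = q \<otimes> (q \<oplus> c \<odot> Y)"
      using q Y by (simp add: W_def r_distr smult_mult_right qq)
    then show ?thesis
      using vnorm_product_le[of q "q \<oplus> c \<odot> Y" 1 "1 + \<delta>"] q q1 Y qY[OF c] by simp
  qed
  define a where "a = (1/2) \<odot> (W \<oplus> adj A W)"
  define b where "b = (-\<i>/2) \<odot> (W \<oplus> (-1) \<odot> adj A W)"
  have sa: "sa a" "sa b" using W unfolding sa_def by (auto simp: a_def b_def smult_add a_comm)
  have qa: "q \<otimes> a = a" "a \<otimes> q = a" and qb: "q \<otimes> b = b" "b \<otimes> q = b"
    using q W by (simp_all add: a_def b_def l_distr r_distr smult_mult_left smult_mult_right rules)
  have Wab: "W = a \<oplus> \<i> \<odot> b"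
    using W by (intro pairing_eqI) (simp_all add: a_def b_def expand field_simps)
  have half: "vnorm A ((1/2) \<odot> (u \<oplus> v)) \<le> r"
    if "u \<in> carrier A" "v \<in> carrier A" "vnorm A u \<le> r" "vnorm A v \<le> r" for u v r
    using that vnorm_triangle[of u v] by (simp add: vnorm_smult norm_divide)
  have a1: "vnorm A a \<le> 1/8" unfolding a_def using W W1 by (intro half) auto
  have b1: "vnorm A b \<le> 1/8"
  proof -
    have "vnorm A b = vnorm A ((1/2) \<odot> (W \<oplus> (-1) \<odot> adj A W))"
      using W by (simp add: b_def vnorm_smult norm_divide norm_mult)
    also have "\<dots> \<le> 1/8" using W W1 by (intro half) auto
    finally show ?thesis .
  qed
  have qan: "vnorm A (q \<oplus> c \<odot> a) \<le> 1 + \<delta>" if c: "c = 1 \<or> c = -1" for c :: complex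
  proof -
    have "q \<oplus> c \<odot> a = (1/2) \<odot> ((q \<oplus> c \<odot> W) \<oplus> adj A (q \<oplus> c \<odot> W))"
      using q W c by (intro pairing_eqI) (auto simp: a_def expand field_simps)
    also have "vnorm A \<dots> \<le> 1 + \<delta>"
    proof (rule half)
      show "vnorm A (adj A (q \<oplus> c \<odot> W)) \<le> 1 + \<delta>"
        using qWn[OF c] q W by (subst vnorm_adj) auto
    qed (use qWn[OF c] q W in auto)
    finally show ?thesis .
  qed
  have an: "vnorm A a \<le> \<alpha>"
    unfolding \<alpha>_def
  proof (rule small_of_corner'[of _ q])
    \<comment> \<open>In the mean of the squares of q + a and q - a the linear terms cancel, so both
      signs are used for the self-adjoint part.\<close>
    have "q \<oplus> q \<otimes> (a \<otimes> a) = (1/2) \<odot> ((q \<oplus> 1 \<odot> a) \<otimes> (q \<oplus> 1 \<odot> a) \<oplus> (q \<oplus> (-1) \<odot> a) \<otimes> (q \<oplus> (-1) \<odot> a))"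
      using q sa by (intro pairing_eqI) (simp_all add: expand qq qa word_eq[OF qa(1)] field_simps)
    also have "vnorm A \<dots> \<le> (1 + \<delta>)\<^sup>2"
      unfolding power2_eq_square using q sa qan[of 1] qan[of "-1"] by (intro half vnorm_product_le) auto
    finally show "vnorm A (q \<oplus> q \<otimes> (a \<otimes> a)) \<le> (1 + \<delta>)\<^sup>2" .
    show "(vnorm A a)\<^sup>2 \<le> vnorm A (q \<otimes> (a \<otimes> a))"
      using q sa by (simp add: word_eq[OF qa(1)] vnorm_square)
  qed (use sa a1 q \<delta> in auto)
  have qbn: "vnorm A (q \<oplus> \<i> \<odot> b) \<le> 1 + (\<delta> + \<alpha>)"
  proof -
    have "q \<oplus> \<i> \<odot> b = (q \<oplus> 1 \<odot> W) \<oplus> (-1) \<odot> a"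
      using q W sa unfolding Wab by (intro pairing_eqI) (simp_all add: expand)
    then show ?thesis
      using vnorm_triangle[of "q \<oplus> 1 \<odot> W" "(-1) \<odot> a"] qWn[of 1] an q W sa by simp
  qed
  have mod_nonneg: "0 \<le> modulus t" if "0 \<le> t" for t
    using that by (simp add: modulus_def)
  have \<alpha>0: "0 \<le> \<alpha>" unfolding \<alpha>_def by (intro mod_nonneg \<delta>)
  have bn: "vnorm A b \<le> \<beta>"
    unfolding \<beta>_def
  proof (rule small_of_corner'[of _ q])
    \<comment> \<open>For the imaginary part one sign suffices, since the cross terms already cancel
      against the adjoint.\<close>
    have "q \<oplus> q \<otimes> (b \<otimes> b) = adj A (q \<oplus> \<i> \<odot> b) \<otimes> (q \<oplus> \<i> \<odot> b)"
      using q sa by (intro pairing_eqI) (simp_all add: expand qq qb word_eq[OF qb(1)] field_simps)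
    then show "vnorm A (q \<oplus> q \<otimes> (b \<otimes> b)) \<le> (1 + (\<delta> + \<alpha>))\<^sup>2"
      using qbn q sa \<delta> \<alpha>0 vnorm_le_iff_adj_mult[of "q \<oplus> \<i> \<odot> b" "1 + (\<delta> + \<alpha>)"] by simp
    show "(vnorm A b)\<^sup>2 \<le> vnorm A (q \<otimes> (b \<otimes> b))"
      using q sa by (simp add: word_eq[OF qb(1)] vnorm_square)
  qed (use sa b1 q \<delta> \<alpha>0 in auto)
  have Wn: "vnorm A W \<le> \<alpha> + \<beta>"
    unfolding Wab using vnorm_triangle[of a "\<i> \<odot> b"] sa an bn by (simp add: vnorm_smult)
  have \<beta>0: "0 \<le> \<beta>" unfolding \<beta>_def by (intro mod_nonneg) (use \<delta> \<alpha>0 in simp)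
  define u where "u = Y \<oplus> (-1) \<odot> W"
  have u: "u \<in> carrier A" using Y W by (simp add: u_def)
  have qu: "q \<otimes> u = \<zero>"
    using q Y W by (simp add: u_def r_distr smult_mult_right W_def[symmetric] qW)
  have uq: "u \<otimes> q = u"
    using q Y W by (simp add: u_def l_distr smult_mult_left Wq Yq)
  have u'q: "adj A u \<otimes> q = \<zero>" using arg_cong[OF qu, of "adj A"] q u by simp
  have qu': "q \<otimes> adj A u = adj A u" using arg_cong[OF uq, of "adj A"] q u by simp
  have uu: "u \<otimes> u = \<zero>"
  proof -
    have "u \<otimes> u = u \<otimes> q \<otimes> u" by (simp add: uq)
    then show ?thesis using q u qu by (simp add: m_assoc)
  qed
  have u'u': "adj A u \<otimes> adj A u = \<zero>" using arg_cong[OF uu, of "adj A"] u by simp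
  note urules = qu uq u'q qu' uu u'u' word_eq[OF qu] word_eq[OF uq] word_eq[OF u'q] word_eq[OF qu']
    word_eq[OF uu] word_eq[OF u'u']
  \<comment> \<open>The bound 1/8 on \<open>y\<close> is chosen for this place: it gives 1/4 for
    \<open>u\<close> and so 1/2 for \<open>T\<close>, the largest norm that
    \<open>small_of_corner\<close> admits.\<close>
  have u1: "vnorm A u \<le> 1/4"
    unfolding u_def using vnorm_triangle[of Y "(-1) \<odot> W"] Y W Y1 W1 by simp
  \<comment> \<open>Since \<open>u\<close> maps the range of \<open>q\<close> to its complement and
    u^2 = 0, the square of \<open>T\<close> is block diagonal and its \<open>q\<close>-block is
    \<open>adj A u \<otimes> u\<close>. Both blocks have norm at most that of \<open>u\<close>
    squared, so cutting by \<open>q\<close> loses nothing.\<close>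
  define T where "T = u \<oplus> adj A u"
  have T: "sa T" using u unfolding sa_def by (simp add: T_def a_comm)
  have TT: "T \<otimes> T = adj A u \<otimes> u \<oplus> u \<otimes> adj A u"
    using u by (simp add: T_def l_distr r_distr uu u'u' a_comm)
  have qTT: "q \<otimes> (T \<otimes> T) = adj A u \<otimes> u"
    using u q by (simp add: TT r_distr urules)
  have "vnorm A (T \<otimes> T) \<le> (vnorm A u)\<^sup>2"
    unfolding TT
  proof (rule vnorm_orthogonal_sum)
    show "adj A u \<otimes> u \<otimes> (u \<otimes> adj A u) = \<zero>"
      using u by (simp add: m_assoc urules)
    show "vnorm A (u \<otimes> adj A u) \<le> (vnorm A u)\<^sup>2"
      using u vnorm_product_le[of u "adj A u"] by (simp add: power2_eq_square)
  qed (use u in \<open>simp_all add: cstar_identity\<close>)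
  then have nT: "(vnorm A T)\<^sup>2 \<le> (vnorm A u)\<^sup>2" using T by (simp add: vnorm_square)
  have "vnorm A T \<le> modulus (\<delta> + \<alpha> + \<beta>)"
  proof (rule small_of_corner'[of _ q])
    show "vnorm A T \<le> 1/2"
      unfolding T_def using vnorm_triangle[of u "adj A u"] u u1 by simp
    show "(vnorm A T)\<^sup>2 \<le> vnorm A (q \<otimes> (T \<otimes> T))"
      unfolding qTT using nT u by (simp add: cstar_identity)
    have eq: "q \<oplus> q \<otimes> (T \<otimes> T) = adj A (q \<oplus> u) \<otimes> (q \<oplus> u)"
      unfolding qTT using q u by (simp add: l_distr r_distr qq urules)
    have "q \<oplus> u = (q \<oplus> 1 \<odot> Y) \<oplus> (-1) \<odot> W"
      using q Y W by (simp add: u_def a_assoc)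
    then have "vnorm A (q \<oplus> u) \<le> 1 + (\<delta> + \<alpha> + \<beta>)"
      using vnorm_triangle[of "q \<oplus> 1 \<odot> Y" "(-1) \<odot> W"] qY[of 1] Wn q Y W by simp
    then show "vnorm A (q \<oplus> q \<otimes> (T \<otimes> T)) \<le> (1 + (\<delta> + \<alpha> + \<beta>))\<^sup>2"
      unfolding eq using q u \<delta> \<alpha>0 \<beta>0 by (subst vnorm_le_iff_adj_mult[symmetric]) auto
  qed (use T q \<delta> \<alpha>0 \<beta>0 in auto)
  moreover have "vnorm A u \<le> vnorm A T"
  proof (rule power2_le_imp_le)
    have "(vnorm A u)\<^sup>2 = vnorm A (q \<otimes> (T \<otimes> T))" unfolding qTT using u by (simp add: cstar_identity)
    also have "\<dots> \<le> 1 * (vnorm A T)\<^sup>2"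
      using q q1 T by (intro vnorm_product_le) (auto simp: vnorm_square)
    finally show "(vnorm A u)\<^sup>2 \<le> (vnorm A T)\<^sup>2" by simp
  qed (use T vnorm_nonneg[of T] in simp)
  moreover have "Y = W \<oplus> u"
    using Y W by (intro pairing_eqI) (simp_all add: u_def expand)
  then have "vnorm A Y \<le> vnorm A W + vnorm A u"
    using vnorm_triangle[of W u] W u by simp
  ultimately show ?thesis using Wn by (simp add: Y_def)
qed

theorem extreme_imp_strongly_extreme:
  assumes x: "linear_extreme_point A (unit_ball A) x"
  shows "strongly_extreme_point A x"
proof -
  have xb: "x \<in> unit_ball A" using x by (simp add: linear_extreme_point_def)
  then have xc: "x \<in> carrier A" and x1: "vnorm A x \<le> 1" by (auto simp: unit_ball_def)
  note iso = extreme_partial_isometry[OF x]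
  have iso': "adj A x \<otimes> (adj A (adj A x) \<otimes> adj A x) = adj A x"
    using arg_cong[OF iso, of "adj A"] xc by (simp add: m_assoc)
  define F where "F \<delta> = modulus \<delta> + modulus (\<delta> + modulus \<delta>) +
    modulus (\<delta> + modulus \<delta> + modulus (\<delta> + modulus \<delta>))" for \<delta>
  have small: "vnorm A y \<le> 3 * F \<delta>"
    if y: "y \<in> carrier A" and y1: "vnorm A y \<le> 1/8" and \<delta>: "0 \<le> \<delta>"
      and pm: "vnorm A (x \<oplus> y) \<le> 1 + \<delta>" "vnorm A (x \<oplus> (-1) \<odot> y) \<le> 1 + \<delta>" for y \<delta>
  proof -
    have 1: "vnorm A (y \<otimes> adj A x) \<le> F \<delta>"
      unfolding F_def by (rule corner_small[OF xc x1 iso y y1 \<delta> pm])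
    \<comment> \<open>The adjoint of \<open>x\<close> is again a partial isometry, so
      \<open>corner_small\<close> applied to the adjoints bounds the product on the other
      side.\<close>
    have "vnorm A (adj A y \<otimes> adj A (adj A x)) \<le> F \<delta>"
      unfolding F_def
    proof (rule corner_small[OF _ _ iso' _ _ \<delta>])
      show "vnorm A (adj A x \<oplus> adj A y) \<le> 1 + \<delta>"
        using pm(1) vnorm_adj[of "x \<oplus> y"] xc y by simp
      show "vnorm A (adj A x \<oplus> (-1) \<odot> adj A y) \<le> 1 + \<delta>"
        using pm(2) vnorm_adj[of "x \<oplus> (-1) \<odot> y"] xc y by simp
    qed (use xc y x1 y1 in simp_all)
    then have 2: "vnorm A (adj A x \<otimes> y) \<le> F \<delta>"
      using vnorm_adj[of "adj A x \<otimes> y"] xc y by simp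
    have F0: "0 \<le> F \<delta>" using order_trans[OF vnorm_nonneg 1] xc y by simp
    define p where "p = adj A x \<otimes> x"
    have p: "p \<in> carrier A" using xc by (simp add: p_def)
    \<comment> \<open>This crude bound gives the factor 3 = 1 + 2 in \<open>small\<close>.\<close>
    have "vnorm A (\<one> \<ominus> p) \<le> 1 + 1"
      using vnorm_one adj_mult_self_le_one[OF xb] p
      by (intro order_trans[OF vnorm_minus_le] add_mono) (auto simp: p_def)
    have "y = y \<otimes> adj A x \<otimes> x \<oplus> x \<otimes> (adj A x \<otimes> y) \<otimes> (\<one> \<ominus> p)"
    proof (rule pairing_eqI)
      fix f
      show "pairing y f = pairing (y \<otimes> adj A x \<otimes> x \<oplus> x \<otimes> (adj A x \<otimes> y) \<otimes> (\<one> \<ominus> p)) f"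
        using arg_cong[OF extreme_annihilates[OF x y], of "\<lambda>v. pairing v f"] xc y
        by (simp add: p_def expand algebra_simps)
    qed (use xc y p in simp_all)
    moreover have "vnorm A (y \<otimes> adj A x \<otimes> x) \<le> F \<delta> * 1"
      using xc y x1 1 by (intro vnorm_product_le) auto
    moreover have "vnorm A (x \<otimes> (adj A x \<otimes> y) \<otimes> (\<one> \<ominus> p)) \<le> 1 * F \<delta> * 2"
      using xc y x1 2 p \<open>vnorm A (\<one> \<ominus> p) \<le> 1 + 1\<close> by (intro vnorm_product_le) auto
    ultimately show ?thesis
      using vnorm_triangle[of "y \<otimes> adj A x \<otimes> x" "x \<otimes> (adj A x \<otimes> y) \<otimes> (\<one> \<ominus> p)"] xc y p by simp
  qed
  have "\<exists>\<delta>>0. \<forall>y\<in>carrier A. vnorm A (x \<oplus> y) \<le> 1 + \<delta> \<and> vnorm A (x \<oplus> (-1) \<odot> y) \<le> 1 + \<delta> \<longrightarrow>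
      vnorm A y \<le> \<epsilon>" if "\<epsilon> > 0" for \<epsilon>
  proof -
    \<comment> \<open>The cap 1/8 is the range in which \<open>corner_small\<close> works.\<close>
    define \<epsilon>' where "\<epsilon>' = min \<epsilon> (1/8)"
    have \<epsilon>': "0 < \<epsilon>'" "\<epsilon>' \<le> \<epsilon>" "\<epsilon>' \<le> 1/8" using that by (auto simp: \<epsilon>'_def)
    have "isCont F 0"
      unfolding F_def modulus_def by (intro continuous_intros)
    then have "(F \<longlongrightarrow> F 0) (at 0)" by (simp add: isCont_def)
    then have "\<forall>\<^sub>F t in at 0. dist (F t) (F 0) < \<epsilon>' / 3"
      using \<epsilon>' by (intro tendstoD) auto
    then obtain d where d: "d > 0" "\<And>t. t \<noteq> 0 \<Longrightarrow> dist t 0 < d \<Longrightarrow> dist (F t) (F 0) < \<epsilon>' / 3"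
      by (auto simp: eventually_at)
    define \<delta> where "\<delta> = d / 2"
    have \<delta>: "\<delta> > 0" and F\<delta>: "3 * F \<delta> < \<epsilon>'"
      using d(1) d(2)[of \<delta>] by (auto simp: \<delta>_def F_def modulus_def dist_real_def)
    have "vnorm A y \<le> \<epsilon>'" if y: "y \<in> carrier A"
      and pm: "vnorm A (x \<oplus> y) \<le> 1 + \<delta>" "vnorm A (x \<oplus> (-1) \<odot> y) \<le> 1 + \<delta>" for y
    proof (rule ccontr)
      assume "\<not> vnorm A y \<le> \<epsilon>'"
      then have big: "\<epsilon>' < vnorm A y" by simp
      \<comment> \<open>A large \<open>y\<close> is shrunk to norm exactly
        \<open>\<epsilon>'\<close>. By convexity, as \<open>x\<close> lies in the ball, the two norm
        bounds survive, and then \<open>small\<close> contradicts the choice of \<delta>. This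
        removes the smallness assumption on \<open>y\<close>.\<close>
      define t where "t = \<epsilon>' / vnorm A y"
      have t: "0 \<le> t" "t \<le> 1" "t * vnorm A y = \<epsilon>'"
        using big \<epsilon>' by (auto simp: t_def)
      have "vnorm A (complex_of_real t \<odot> y) = \<epsilon>'" using t y by (simp add: vnorm_smult)
      moreover have "vnorm A (x \<oplus> complex_of_real t \<odot> y) \<le> 1 + \<delta>"
        using xc y x1 \<delta> pm t by (intro vnorm_add_scaled) auto
      moreover have "vnorm A (x \<oplus> complex_of_real t \<odot> ((-1) \<odot> y)) \<le> 1 + \<delta>"
        using xc y x1 \<delta> pm t by (intro vnorm_add_scaled) auto
      ultimately have "\<epsilon>' \<le> 3 * F \<delta>"
        using small[of "complex_of_real t \<odot> y" \<delta>] y \<epsilon>' \<delta> by simp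
      then show False using F\<delta> by simp
    qed
    then show ?thesis using \<delta> \<epsilon>' by (meson order_trans)
  qed
  then show ?thesis using xb by (simp add: strongly_extreme_point_def)
qed

end

theorem theorem2p3:
  fixes A :: "'a star_alg" and x :: 'a
  assumes "unital_cstar_algebra A"
    and "linear_extreme_point A (unit_ball A) x"
  shows "linear_extreme_point (bidual A) (unit_ball (bidual A)) (canonical_embedding A x) \<and>
    weak_star_extreme_point A x \<and>
    (\<forall>n (D :: nat \<Rightarrow> 'u nspace) \<iota> T. dual_tower A (2 * n) D \<iota> T \<longrightarrow>
       weak_star_extreme_point (D (2 * n)) (even_dual_embedding D \<iota> T n x))"
proof -
  interpret unital_cstar_algebra A by (rule assms)
  have x: "strongly_extreme_point A x" by (rule extreme_imp_strongly_extreme[OF assms(2)])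
  have A: "complex_normed_space A" by unfold_locales
  show ?thesis
  proof (intro conjI allI impI)
    show w: "weak_star_extreme_point A x"
      by (rule strongly_extreme_imp_weak_star_extreme[OF A x])
    then show "linear_extreme_point (bidual A) (unit_ball (bidual A)) (canonical_embedding A x)"
      by (simp add: weak_star_extreme_point_def)
    fix n \<iota> T and D :: "nat \<Rightarrow> 'u nspace" assume "dual_tower A (2 * n) D \<iota> T"
    from strongly_extreme_tower[OF A x this]
    show "weak_star_extreme_point (D (2 * n)) (even_dual_embedding D \<iota> T n x)"
      by (intro strongly_extreme_imp_weak_star_extreme) auto
  qed
qed

end
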